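(* Fix an integer $d\ge 2$ and let $p(n,d)$ be the complexity function of the language of the billiard in the hypercube $[0,1]^d$ coded with $d$ letters. Then there exist constants $C_1,C_2>0$ such that for all $n\ge 1$, $$C_1 n^{3d-3}\le p(n,d)\le C_2 n^{3d-3}.$$
   Context: The billiard in the hypercube $P=[0,1]^d$: a point moves with unit speed along straight lines inside $P$ and reflects on the boundary by the mirror law; the billiard map $T$ is the induced map on the phase space (pairs of a boundary point and a direction). The boundary is coded by $d$ letters by giving the same letter to the two parallel $(d-1)$-dimensional faces orthogonal to the $i$-th coordinate axis, $i=1,\dots,d$. Each billiard orbit segment hitting $n$ faces (and never hitting faces of dimension $\le d-2$) yields a word of length $n$ (the sequence of letters of the faces hit). $\mathcal{L}(n,d)$ is the set of such words of length $n$, and $p(n,d)=\mathrm{card}\,\mathcal{L}(n,d)$; equivalently $p(n,d)$ is the number of atoms of the partition $\bigvee_{i=0}^{n}T^{-i}\mathcal{P}$, where $\mathcal{P}$ is the partition of the phase space into the $d$ sets determined by the letter of the face. *)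

theory Defs
  imports "HOL-Analysis.Analysis"
begin

text \<open>Folding map of the real line onto [0,1]: the distance to the nearest even integer.
  One coordinate of a billiard trajectory in [0,1] moving with constant speed and
  reflecting elastically at 0 and 1 is  fold (x + t*v).\<close>
definition fold01 :: "real \<Rightarrow> real" where
  "fold01 s = \<bar>s - 2 * of_int \<lfloor>(s + 1) / 2\<rfloor>\<bar>"

text \<open>Billiard flow in the hypercube [0,1]^d (d = CARD('d)): start data x (unfolded
  position), velocity v; coordinates move independently and the i-th component of the
  velocity is reversed exactly when the i-th coordinate reaches 0 or 1 (mirror law on
  faces orthogonal to the i-th axis).\<close>
definition billiard_pos :: "real^('d::finite) \<Rightarrow> real^('d::finite) \<Rightarrow> real \<Rightarrow> real^('d::finite)" where
  "billiard_pos x v t = (\<chi> i. fold01 (x $ i + t * v $ i))"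

definition hits_face :: "real^('d::finite) \<Rightarrow> real^('d::finite) \<Rightarrow> real \<Rightarrow> 'd \<Rightarrow> bool" where
  "hits_face x v t i \<longleftrightarrow> billiard_pos x v t $ i \<in> {0, 1}"

text \<open>L(n,d): words of length n coding orbit segments (time interval [a,b], unit speed)
  hitting exactly n faces at times s 0 < ... < s (n-1), each time exactly one face
  (so no face of dimension \<le> d-2 is hit).\<close>
definition billiard_language :: "nat \<Rightarrow> ('d::finite) list set" where
  "billiard_language n = {w. length w = n \<and>
     (\<exists>(x::real^('d::finite)) (v::real^('d::finite)) (a::real) (b::real) (s::nat \<Rightarrow> real).
        norm v = 1 \<and>
        (\<forall>k. Suc k < n \<longrightarrow> s k < s (Suc k)) \<and>
        {t \<in> {a..b}. \<exists>i. hits_face x v t i} = s ` {..<n} \<and>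
        (\<forall>k<n. \<forall>i. hits_face x v (s k) i \<longleftrightarrow> i = w ! k))}"

definition billiard_complexity :: "('d::finite) itself \<Rightarrow> nat \<Rightarrow> nat" where
  "billiard_complexity _ n = card (billiard_language n :: 'd list set)"

end

theory Submission
  imports Defs
begin

text \<open>Unfolding the trajectory, the hits of letter \<open>i\<close> form an arithmetic progression
  \<open>\<tau> i + p * A i\<close>, and the word records the order in which these \<open>d\<close> progressions interleave.

  Upper bound: let \<open>m\<close> be the fastest letter and fix the frequencies \<open>A m / A i\<close> up to \<open>1/n\<close>,
  which leaves \<open>O(n^(d-1))\<close> cells. Inside one cell only \<open>O(n)\<close> comparisons of two events
  matter. Each is the sign of an affine function of \<open>2d-2\<close> parameters, as time translations and
  scalings act trivially, so by the Sauer-Shelah lemma a cell contributes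
  \<open>O(n^(2d-2))\<close> words.

  Lower bound: let letter \<open>m\<close> be hit at the integer times. The number of hits of
  another letter before time \<open>t\<close> is then a digitized line, of which there are at least \<open>c n^3\<close>
  on \<open>{0..n}\<close>; the lines of the \<open>d-1\<close> other letters can be chosen independently.\<close>

subsection \<open>Sign patterns of affine functions\<close>

text \<open>Comparing all pairs of events would involve about \<open>n^2\<close> affine functions
  and give only \<open>n^(4d-4)\<close>. The cells cost a factor \<open>n^(d-1)\<close> but leave
  \<open>n^(2d-2)\<close> for the patterns: with the frequencies known up to \<open>1/n\<close>, an
  event of the faster of two letters can compete for a place with boundedly many events of the
  slower one. These comparisons suffice because a word can be read off greedily: its next letter is
  the one whose next event is earliest, and the index of that event is the number of earlier
  occurrences of the letter. Taking the fastest letter as reference keeps all relative frequencies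
  at most 1, which bounds the number of cells.

  In the lower bound, the \<open>n^3\<close> lines per letter come from about \<open>n^2\<close>
  slopes \<open>p/q\<close> in lowest terms with about \<open>n\<close> intercepts each. With
  rational data several faces could be hit at once, so every intercept is shifted by a generic
  amount below \<open>1/q\<close>, which the digitization does not see.\<close>

definition shatters :: "'a set set \<Rightarrow> 'a set \<Rightarrow> bool" where
  "shatters F Y \<longleftrightarrow> (\<forall>Z\<subseteq>Y. \<exists>S\<in>F. S \<inter> Y = Z)"

text \<open>Pajor's strengthening of the Sauer-Shelah lemma. Deleting the point \<open>x\<close>
  yields the traces \<open>F0\<close>, and among them the traces \<open>F1\<close> that extend both
  with and without \<open>x\<close>. Sets shattered by \<open>F0\<close> remain shattered by
  \<open>F\<close>; those shattered by \<open>F1\<close> remain so after \<open>x\<close> is added,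
  and membership of \<open>x\<close> tells the two kinds apart.\<close>

lemma card_le_card_shattered:
  assumes "finite R" "F \<subseteq> Pow R"
  shows "card F \<le> card {Y. Y \<subseteq> R \<and> shatters F Y}"
  using assms
proof (induction R arbitrary: F rule: finite_induct)
  case empty
  show ?case
  proof (cases "F = {}")
    case False
    then have F: "F = {{}}" using empty by auto
    then have "{Y. Y \<subseteq> {} \<and> shatters F Y} = {{}}" by (auto simp: shatters_def)
    then show ?thesis using F by simp
  qed simp
next
  case (insert x R)
  define F0 where "F0 = (\<lambda>S. S - {x}) ` F"
  define F1 where "F1 = {S. x \<notin> S \<and> S \<in> F \<and> insert x S \<in> F}"
  define G where "G = {S\<in>F. x \<in> S \<and> S - {x} \<in> F}"
  have finF: "finite F" using finite_subset[OF insert.prems] insert.hyps by simp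
  have "bij_betw (\<lambda>S. S - {x}) G F1"
    by (rule bij_betwI[where g="insert x"]) (auto simp: G_def F1_def insert_absorb)
  then have cG: "card G = card F1" by (rule bij_betw_same_card)
  \<comment> \<open>A trace has one or two preimages in \<open>F\<close>; where there are two,
    \<open>G\<close> takes away the one containing \<open>x\<close>.\<close>
  have "inj_on (\<lambda>S. S - {x}) (F - G)"
  proof (rule inj_onI)
    fix S T assume S: "S \<in> F - G" and T: "T \<in> F - G" and eq: "S - {x} = T - {x}"
    show "S = T"
    proof (cases "x \<in> S \<longleftrightarrow> x \<in> T")
      case True
      then show ?thesis using eq by blast
    next
      case False
      then have "S - {x} \<in> F" using S T eq by (cases "x \<in> S") auto
      then show ?thesis using S T eq False unfolding G_def by auto
    qed
  qed
  moreover have "(\<lambda>S. S - {x}) ` (F - G) = F0"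
  proof
    show "F0 \<subseteq> (\<lambda>S. S - {x}) ` (F - G)"
    proof
      fix T assume "T \<in> F0"
      then obtain S where S: "S \<in> F" "T = S - {x}" by (auto simp: F0_def)
      show "T \<in> (\<lambda>S. S - {x}) ` (F - G)"
      proof (cases "S \<in> G")
        case True
        then have "T \<in> F - G" "T - {x} = T" using S by (auto simp: G_def)
        then show ?thesis by (metis imageI)
      qed (use S in auto)
    qed
  qed (auto simp: F0_def)
  ultimately have "card (F - G) = card F0" by (metis card_image)
  moreover have "card F = card (F - G) + card G"
    using finF card_Diff_subset[of G F] card_mono[of F G] finite_subset[of G F] by (auto simp: G_def)
  ultimately have cF: "card F = card F0 + card F1" using cG by simp
  have i0: "card F0 \<le> card {Y. Y \<subseteq> R \<and> shatters F0 Y}"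
    by (rule insert.IH) (use insert.prems in \<open>auto simp: F0_def\<close>)
  have i1: "card F1 \<le> card {Y. Y \<subseteq> R \<and> shatters F1 Y}"
    by (rule insert.IH) (use insert.prems in \<open>auto simp: F1_def\<close>)
  let ?A = "{Y. Y \<subseteq> R \<and> shatters F0 Y}" and ?B = "{Y. Y \<subseteq> R \<and> shatters F1 Y}"
  have fin: "finite ?A" "finite ?B" "finite {Y. Y \<subseteq> insert x R \<and> shatters F Y}"
    using insert.hyps by auto
  have "inj_on (insert x) ?B"
    using insert.hyps unfolding inj_on_def by (metis (no_types, lifting) insert_ident mem_Collect_eq subsetD)
  then have "card (insert x ` ?B) = card ?B" by (rule card_image)
  moreover have "?A \<inter> insert x ` ?B = {}" using insert.hyps by auto
  ultimately have "card ?A + card ?B = card (?A \<union> insert x ` ?B)"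
    using fin by (simp add: card_Un_disjoint)
  also have "\<dots> \<le> card {Y. Y \<subseteq> insert x R \<and> shatters F Y}"
  proof (rule card_mono[OF fin(3)], safe)
    fix Y assume Y: "Y \<subseteq> R" "shatters F0 Y"
    have "x \<notin> Y" using Y insert.hyps by auto
    show "shatters F Y" unfolding shatters_def
    proof (intro allI impI)
      fix Z assume "Z \<subseteq> Y"
      then have "\<exists>T\<in>F0. T \<inter> Y = Z" using Y(2) by (simp add: shatters_def)
      then obtain T where "T \<in> F0" "T \<inter> Y = Z" by auto
      then obtain S where "S \<in> F" "(S - {x}) \<inter> Y = Z" by (auto simp: F0_def)
      then show "\<exists>S\<in>F. S \<inter> Y = Z" using \<open>x \<notin> Y\<close> by (intro bexI[of _ S]) auto
    qed
  next
    fix Y assume Y: "Y \<subseteq> R" "shatters F1 Y"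
    have xY: "x \<notin> Y" using Y insert.hyps by auto
    show "shatters F (insert x Y)" unfolding shatters_def
    proof (intro allI impI)
      fix Z assume Z: "Z \<subseteq> insert x Y"
      then have "Z - {x} \<subseteq> Y" by auto
      then have "\<exists>S\<in>F1. S \<inter> Y = Z - {x}" using Y(2) by (simp add: shatters_def)
      then obtain S where S: "S \<in> F1" "S \<inter> Y = Z - {x}" by auto
      show "\<exists>S\<in>F. S \<inter> insert x Y = Z"
      proof (cases "x \<in> Z")
        case True
        then show ?thesis using S xY Z by (intro bexI[of _ "insert x S"]) (auto simp: F1_def)
      next
        case False
        then show ?thesis using S xY Z by (intro bexI[of _ S]) (auto simp: F1_def)
      qed
    qed
  qed auto
  finally show ?case using cF i0 i1 by linarith
qed

lemma card_subsets_card_le: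
  assumes "finite R"
  shows "card {Y. Y \<subseteq> R \<and> card Y \<le> D} \<le> (card R + 1) ^ D"
proof (induction D)
  case 0
  have "{Y. Y \<subseteq> R \<and> card Y \<le> 0} \<subseteq> {{}}"
    using finite_subset[OF _ assms] by (auto simp: card_eq_0_iff)
  from card_mono[OF _ this] show ?case by simp
next
  case (Suc D)
  let ?B = "{Y. Y \<subseteq> R \<and> card Y \<le> D}"
  have fB: "finite ?B" using assms by auto
  have "{Y. Y \<subseteq> R \<and> card Y \<le> Suc D} \<subseteq> ?B \<union> (\<lambda>(r,Y). insert r Y) ` (R \<times> ?B)"
  proof
    fix Y assume Y: "Y \<in> {Y. Y \<subseteq> R \<and> card Y \<le> Suc D}"
    show "Y \<in> ?B \<union> (\<lambda>(r,Y). insert r Y) ` (R \<times> ?B)"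
    proof (cases "card Y \<le> D")
      case False
      then obtain y where y: "y \<in> Y" by fastforce
      have "finite Y" using Y assms finite_subset by auto
      then have "card (Y - {y}) \<le> D" using Y y by auto
      then have "(y, Y - {y}) \<in> R \<times> ?B" using Y y by auto
      moreover have "Y = (\<lambda>(r,Y). insert r Y) (y, Y - {y})" using y by auto
      ultimately show ?thesis by blast
    qed (use Y in auto)
  qed
  then have "card {Y. Y \<subseteq> R \<and> card Y \<le> Suc D} \<le> card (?B \<union> (\<lambda>(r,Y). insert r Y) ` (R \<times> ?B))"
    using assms fB by (intro card_mono) auto
  also have "\<dots> \<le> card ?B + card ((\<lambda>(r,Y). insert r Y) ` (R \<times> ?B))" by (rule card_Un_le)
  also have "\<dots> \<le> card ?B + card (R \<times> ?B)" using assms fB by (intro add_mono card_image_le) auto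
  also have "\<dots> = (card R + 1) * card ?B" by (simp add: card_cartesian_product)
  also have "\<dots> \<le> (card R + 1) ^ Suc D" using Suc by (simp only: power_Suc mult_le_mono2)
  finally show ?case .
qed

lemma sauer_shelah:
  assumes "finite R" "F \<subseteq> Pow R" and "\<And>Y. Y \<subseteq> R \<Longrightarrow> shatters F Y \<Longrightarrow> card Y \<le> D"
  shows "card F \<le> (card R + 1) ^ D"
proof -
  have "card F \<le> card {Y. Y \<subseteq> R \<and> shatters F Y}" by (rule card_le_card_shattered) fact+
  also have "\<dots> \<le> card {Y. Y \<subseteq> R \<and> card Y \<le> D}" using assms by (intro card_mono) auto
  also have "\<dots> \<le> (card R + 1) ^ D" by (rule card_subsets_card_le) fact
  finally show ?thesis .
qed

text \<open>Gaussian elimination: a vector \<open>g y\<close> that is nonzero at \<open>a\<close>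
  serves as pivot, and subtracting multiples of it eliminates \<open>a\<close> and \<open>y\<close>
  together. The coefficient \<open>- c\<close> finally given to \<open>y\<close> accounts for these
  subtractions.\<close>

lemma linear_dependence:
  fixes g :: "'x \<Rightarrow> 'i \<Rightarrow> real"
  assumes "finite I" "finite X" "card I < card X"
  shows "\<exists>l. (\<exists>x\<in>X. l x \<noteq> 0) \<and> (\<forall>i\<in>I. (\<Sum>x\<in>X. l x * g x i) = 0)"
  using assms
proof (induction I arbitrary: X g rule: finite_induct)
  case empty
  then obtain x where "x \<in> X" by fastforce
  then show ?case by (intro exI[of _ "\<lambda>_. 1"]) auto
next
  case (insert a I)
  show ?case
  proof (cases "\<forall>x\<in>X. g x a = 0")
    case True
    have "\<exists>l. (\<exists>x\<in>X. l x \<noteq> 0) \<and> (\<forall>i\<in>I. (\<Sum>x\<in>X. l x * g x i) = 0)"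
      by (rule insert.IH) (use insert in auto)
    then show ?thesis using True by auto
  next
    case False
    then obtain y where y: "y \<in> X" "g y a \<noteq> 0" by auto
    define h where "h x i = g x i - g x a / g y a * g y i" for x i
    have "\<exists>l. (\<exists>x\<in>X - {y}. l x \<noteq> 0) \<and> (\<forall>i\<in>I. (\<Sum>x\<in>X - {y}. l x * h x i) = 0)"
      by (rule insert.IH) (use insert y in auto)
    then obtain l where l: "\<exists>x\<in>X - {y}. l x \<noteq> 0" "\<And>i. i \<in> I \<Longrightarrow> (\<Sum>x\<in>X - {y}. l x * h x i) = 0" by auto
    define c where "c = (\<Sum>x\<in>X - {y}. l x * (g x a / g y a))"
    define l' where "l' = l(y := - c)"
    have sum': "(\<Sum>x\<in>X. l' x * g x i) = (\<Sum>x\<in>X - {y}. l x * h x i)" for i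
    proof -
      have "(\<Sum>x\<in>X. l' x * g x i) = l' y * g y i + (\<Sum>x\<in>X - {y}. l' x * g x i)"
        using y insert by (simp add: sum.remove)
      also have "(\<Sum>x\<in>X - {y}. l' x * g x i) = (\<Sum>x\<in>X - {y}. l x * g x i)"
        by (rule sum.cong) (auto simp: l'_def)
      also have "l' y * g y i = - (\<Sum>x\<in>X - {y}. l x * (g x a / g y a) * g y i)"
        by (simp add: l'_def c_def sum_distrib_right)
      finally show ?thesis
        by (simp add: h_def sum_subtractf[symmetric] right_diff_distrib mult.assoc)
    qed
    have "(\<Sum>x\<in>X. l' x * g x i) = 0" if "i \<in> insert a I" for i
      using that l(2) y by (cases "i = a") (auto simp: sum' h_def)
    moreover have "\<exists>x\<in>X. l' x \<noteq> 0" using l(1) by (auto simp: l'_def)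
    ultimately show ?thesis by blast
  qed
qed

text \<open>The functions are affine on a space of dimension \<open>card I\<close>; a linear dependence of their
  gradients makes a fixed combination constant, so two opposite sign patterns exclude each other.\<close>

lemma card_sign_patterns:
  fixes f0 :: "'x \<Rightarrow> real" and g :: "'x \<Rightarrow> 'i \<Rightarrow> real"
  assumes "finite I" "finite R"
  shows "card (range (\<lambda>u. {x\<in>R. f0 x + (\<Sum>i\<in>I. g x i * u i) > 0})) \<le> (card R + 1) ^ card I"
proof (rule sauer_shelah[OF \<open>finite R\<close>])
  let ?f = "\<lambda>u x. f0 x + (\<Sum>i\<in>I. g x i * u i)"
  let ?F = "range (\<lambda>u. {x\<in>R. ?f u x > 0})"
  show "?F \<subseteq> Pow R" by auto
  fix Y assume Y: "Y \<subseteq> R" "shatters ?F Y"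
  have fY: "finite Y" using Y assms finite_subset by auto
  show "card Y \<le> card I"
  proof (rule ccontr)
    assume "\<not> card Y \<le> card I"
    then obtain l where l: "\<exists>x\<in>Y. l x \<noteq> 0" "\<And>i. i \<in> I \<Longrightarrow> (\<Sum>x\<in>Y. l x * g x i) = 0"
      using linear_dependence[OF \<open>finite I\<close> fY, of g] by (meson not_le)
    define K where "K = (\<Sum>x\<in>Y. l x * f0 x)"
    have K: "(\<Sum>x\<in>Y. l x * ?f u x) = K" for u
    proof -
      have "(\<Sum>x\<in>Y. l x * (\<Sum>i\<in>I. g x i * u i)) = (\<Sum>i\<in>I. (\<Sum>x\<in>Y. l x * g x i) * u i)"
        by (simp add: sum_distrib_left sum_distrib_right mult.assoc sum.swap[of _ I])
      also have "\<dots> = 0" using l(2) by simp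
      finally show ?thesis by (simp add: distrib_left sum.distrib K_def)
    qed
    have pat: "\<exists>u. \<forall>x\<in>Y. ?f u x > 0 \<longleftrightarrow> x \<in> Z" if "Z \<subseteq> Y" for Z
    proof -
      have "\<exists>S\<in>?F. S \<inter> Y = Z" using Y(2) that by (simp add: shatters_def)
      then obtain u where "{x\<in>R. ?f u x > 0} \<inter> Y = Z" by auto
      then show ?thesis using Y by (intro exI[of _ u]) blast
    qed
    \<comment> \<open>\<open>u\<close> makes every product \<open>l x * ?f u x\<close> nonnegative
      and \<open>w\<close> makes every product \<open>l x * ?f w x\<close> nonpositive, while both
      sums equal \<open>K\<close>.\<close>
    obtain u where u: "\<forall>x\<in>Y. ?f u x > 0 \<longleftrightarrow> x \<in> {x\<in>Y. l x > 0}" using pat[of "{x\<in>Y. l x > 0}"] by auto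
    obtain w where w: "\<forall>x\<in>Y. ?f w x > 0 \<longleftrightarrow> x \<in> {x\<in>Y. l x < 0}" using pat[of "{x\<in>Y. l x < 0}"] by auto
    have pu: "l x * ?f u x \<ge> 0" if "x \<in> Y" for x
    proof (cases "l x > 0")
      case True
      then show ?thesis using u that by (intro mult_nonneg_nonneg) auto
    next
      case False
      then show ?thesis using u that by (intro mult_nonpos_nonpos) force+
    qed
    have pw: "- (l x * ?f w x) \<ge> 0" if "x \<in> Y" for x
    proof (cases "l x < 0")
      case True
      then show ?thesis using w that by (simp add: mult_nonpos_nonneg less_imp_le)
    next
      case False
      then have "?f w x \<le> 0" using w that by force
      then show ?thesis using False by (simp add: mult_nonneg_nonpos)
    qed
    have "K \<ge> 0" using sum_nonneg[of Y "\<lambda>x. l x * ?f u x"] pu K[of u] by simp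
    moreover have "- K \<ge> 0" using sum_nonneg[of Y "\<lambda>x. - (l x * ?f w x)"] pw K[of w] by (simp add: sum_negf)
    ultimately have "K = 0" by simp
    \<comment> \<open>With \<open>K = 0\<close> every summand vanishes. But \<open>?f u x\<close> is
      positive wherever \<open>l x > 0\<close>, and \<open>?f w x\<close> wherever
      \<open>l x < 0\<close>, so \<open>l\<close> is zero on \<open>Y\<close>.\<close>
    then have "\<forall>x\<in>Y. l x * ?f u x = 0" "\<forall>x\<in>Y. - (l x * ?f w x) = 0"
      using sum_nonneg_eq_0_iff[OF fY, of "\<lambda>x. l x * ?f u x"] pu K[of u]
        sum_nonneg_eq_0_iff[OF fY, of "\<lambda>x. - (l x * ?f w x)"] pw K[of w] by (auto simp: sum_negf)
    then have "\<forall>x\<in>Y. \<not> l x > 0 \<and> \<not> l x < 0" using u w by fastforce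
    then show False using l(1) by force
  qed
qed

subsection \<open>Order patterns of interleaved progressions\<close>

text \<open>A quadruple \<open>(i, p, j, q)\<close> stands for the comparison of the \<open>p\<close>-th hit of letter \<open>i\<close> with
  the \<open>q\<close>-th hit of letter \<open>j\<close>. Those in \<open>close_events \<beta>\<close> are the only ones that can occur at the same
  place of a word of length \<open>n\<close> when the relative frequencies are \<open>\<beta> i / n\<close> up to an error \<open>1/n\<close>.\<close>

definition close_events :: "('a \<Rightarrow> nat) \<Rightarrow> ('a \<times> nat \<times> 'a \<times> nat) set" where
  "close_events \<beta> = {(i, p, j, q). p \<le> \<beta> i + 1 \<and> q \<le> \<beta> j + 1 \<and>
     \<bar>int p * int (\<beta> j) - int q * int (\<beta> i)\<bar> \<le> 2 * (int (\<beta> i) + int (\<beta> j)) + 3}"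

text \<open>For \<open>c > 0\<close> the right-hand side is at most \<open>7 * c\<close>, as
  \<open>b \<le> c\<close>. So for fixed \<open>q\<close> the number \<open>p\<close> lies within 7
  of \<open>q * b / c\<close>, which leaves 15 values, and \<open>q\<close> has
  \<open>c + 2 \<le> 3 * n\<close> values.\<close>

lemma card_near_slope:
  fixes b c n :: nat
  assumes "b \<le> c" "c \<le> n" "n \<ge> 1"
  shows "card {(p::nat, q::nat). p \<le> b + 1 \<and> q \<le> c + 1 \<and>
     \<bar>int p * int c - int q * int b\<bar> \<le> 2 * (int b + int c) + 3} \<le> 45 * n" (is "card ?S \<le> _")
proof -
  define P where "P q = {p. p \<le> b + 1 \<and> \<bar>int p * int c - int q * int b\<bar> \<le> 2 * (int b + int c) + 3}" for q :: nat
  have P: "card (P q) \<le> 15" for q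
  proof (cases "c = 0")
    case True
    then have "P q \<subseteq> {..1}" using assms by (auto simp: P_def)
    then have "card (P q) \<le> card {..1::nat}" by (intro card_mono) auto
    then show ?thesis by simp
  next
    case False
    define D where "D = (int q * int b) div int c"
    define r where "r = (int q * int b) mod int c"
    have qb: "int q * int b = int c * D + r" by (simp add: D_def r_def)
    have r: "0 \<le> r" "r < int c" using False by (auto simp: r_def)
    have "P q \<subseteq> nat ` {D - 7..D + 7}"
    proof
      fix p assume "p \<in> P q"
      then have h: "\<bar>int p * int c - int q * int b\<bar> \<le> 7 * int c" using assms False by (auto simp: P_def)
      then have "int p * int c < (D + 8) * int c" using qb r by (simp add: algebra_simps)
      then have u: "int p < D + 8" using False by (simp add: mult_less_cancel_right)
      have "(D - 8) * int c < int p * int c" using h qb r False by (simp add: algebra_simps)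
      then have "D - 8 < int p" using False by (simp add: mult_less_cancel_right)
      then have "int p \<in> {D - 7..D + 7}" using u by auto
      then show "p \<in> nat ` {D - 7..D + 7}" by (metis image_eqI nat_int)
    qed
    then have "card (P q) \<le> card (nat ` {D - 7..D + 7})" by (intro card_mono) auto
    also have "\<dots> \<le> card {D - 7..D + 7}" by (rule card_image_le) auto
    finally show ?thesis by simp
  qed
  have fP: "finite (P q)" for q by (rule finite_subset[of _ "{..b + 1}"]) (auto simp: P_def)
  have "?S \<subseteq> prod.swap ` (Sigma {..c + 1} P)"
    by (auto simp: P_def image_iff)
  then have "card ?S \<le> card (prod.swap ` (Sigma {..c + 1} P))" using fP by (intro card_mono) auto
  also have "\<dots> \<le> card (Sigma {..c + 1} P)" by (rule card_image_le) (use fP in auto)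
  also have "\<dots> = (\<Sum>q\<le>c + 1. card (P q))" using fP by simp
  also have "\<dots> \<le> (\<Sum>q\<le>c + 1. 15)" by (intro sum_mono P)
  also have "\<dots> \<le> 45 * n" using assms by simp
  finally show ?thesis .
qed

lemma close_events_bound:
  fixes \<beta> :: "'d::finite \<Rightarrow> nat"
  assumes "\<And>i. \<beta> i \<le> n" "n \<ge> 1"
  shows "finite (close_events \<beta>)" "card (close_events \<beta>) \<le> 45 * CARD('d)^2 * n"
proof -
  define T where "T i j = {(p::nat, q::nat). p \<le> \<beta> i + 1 \<and> q \<le> \<beta> j + 1 \<and>
     \<bar>int p * int (\<beta> j) - int q * int (\<beta> i)\<bar> \<le> 2 * (int (\<beta> i) + int (\<beta> j)) + 3}" for i j
  have fT: "finite (T i j)" for i j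
    by (rule finite_subset[of _ "{..\<beta> i + 1} \<times> {..\<beta> j + 1}"]) (auto simp: T_def)
  have cT: "card (T i j) \<le> 45 * n" for i j
  proof (cases "\<beta> i \<le> \<beta> j")
    case True
    then show ?thesis unfolding T_def using assms by (intro card_near_slope) auto
  next
    case False
    \<comment> \<open>The window argument needs the slower letter in first place, so the quadruple
      is reversed.\<close>
    have "T i j = prod.swap ` T j i"
      by (auto simp: T_def image_iff abs_minus_commute add.commute mult.commute)
    then have "card (T i j) \<le> card (T j i)" using fT by (metis card_image_le)
    also have "\<dots> \<le> 45 * n" unfolding T_def using assms False by (intro card_near_slope) auto
    finally show ?thesis .
  qed
  have eq: "close_events \<beta> = (\<lambda>((i,j),(p,q)). (i,p,j,q)) ` (Sigma UNIV (\<lambda>(i,j). T i j))"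
    by (auto simp: close_events_def T_def image_iff)
  have fS: "finite (Sigma UNIV (\<lambda>(i,j). T i j))" using fT by (intro finite_SigmaI) auto
  then show "finite (close_events \<beta>)" unfolding eq by (rule finite_imageI)
  have "card (close_events \<beta>) \<le> card (Sigma UNIV (\<lambda>(i,j). T i j))"
    unfolding eq by (rule card_image_le[OF fS])
  also have "\<dots> = (\<Sum>(i,j)\<in>UNIV. card (T i j))" using fT by (simp add: case_prod_unfold)
  also have "\<dots> \<le> (\<Sum>(i,j)\<in>(UNIV::('d\<times>'d) set). 45 * n)" using cT by (intro sum_mono) auto
  also have "\<dots> = 45 * CARD('d)^2 * n" by (simp add: card_cartesian_product power2_eq_square)
  finally show "card (close_events \<beta>) \<le> 45 * CARD('d)^2 * n" .
qed

definition order_pattern :: "('a \<Rightarrow> nat) \<Rightarrow> ('a \<Rightarrow> real) \<Rightarrow> ('a \<Rightarrow> real) \<Rightarrow> ('a \<times> nat \<times> 'a \<times> nat) set" where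
  "order_pattern \<beta> A \<tau> = {(i, p, j, q) \<in> close_events \<beta>. \<tau> i + real p * A i < \<tau> j + real q * A j}"

text \<open>Invariance under time translation and scaling removes the two parameters of letter \<open>m\<close>.\<close>

lemma card_order_patterns:
  fixes \<beta> :: "'d::finite \<Rightarrow> nat"
  assumes "\<And>i. \<beta> i \<le> n" "n \<ge> 1"
  shows "finite {order_pattern \<beta> A \<tau> |A \<tau>. A m > 0}"
    "card {order_pattern \<beta> A \<tau> |A \<tau>. A m > 0} \<le> (45 * CARD('d)^2 * n + 1) ^ (2 * CARD('d) - 2)"
proof -
  \<comment> \<open>Normalized to \<open>A m = 1\<close> and \<open>\<tau> m = 0\<close>, the letter
    \<open>m\<close> contributes only the constants in \<open>f0\<close>. Every other letter has two
    parameters: its period (index \<open>True\<close>) and its offset (index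
    \<open>False\<close>).\<close>
  define f0 :: "'d \<times> nat \<times> 'd \<times> nat \<Rightarrow> real" where
    "f0 = (\<lambda>(i,p,j,q). (if j = m then real q else 0) - (if i = m then real p else 0))"
  define g :: "'d \<times> nat \<times> 'd \<times> nat \<Rightarrow> 'd \<times> bool \<Rightarrow> real" where
    "g = (\<lambda>(i,p,j,q) (l,b). (if l = j then if b then real q else 1 else 0) - (if l = i then if b then real p else 1 else 0))"
  define I where "I = (UNIV - {m}) \<times> (UNIV::bool set)"
  let ?P = "range (\<lambda>u. {x\<in>close_events \<beta>. f0 x + (\<Sum>l\<in>I. g x l * u l) > 0})"
  have sub: "{order_pattern \<beta> A \<tau> |A \<tau>. A m > 0} \<subseteq> ?P"
  proof clarify
    fix A \<tau> :: "'d \<Rightarrow> real" assume Am: "A m > 0"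
    define u where "u = (\<lambda>(l,b). if b then A l / A m else (\<tau> l - \<tau> m) / A m)"
    have *: "f0 (i,p,j,q) + (\<Sum>l\<in>I. g (i,p,j,q) l * u l) = ((\<tau> j + real q * A j) - (\<tau> i + real p * A i)) / A m" for i p j q
    proof -
      have "(\<Sum>l\<in>I. g (i,p,j,q) l * u l) = (\<Sum>l\<in>UNIV - {m}. \<Sum>b\<in>UNIV. g (i,p,j,q) (l,b) * u (l,b))"
        unfolding I_def by (simp add: sum.cartesian_product)
      also have "\<dots> = (\<Sum>l\<in>UNIV - {m}. (if l = j then real q * A l / A m + (\<tau> l - \<tau> m) / A m else 0)
          - (if l = i then real p * A l / A m + (\<tau> l - \<tau> m) / A m else 0))"
        by (rule sum.cong) (auto simp: UNIV_bool g_def u_def algebra_simps)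
      also have "\<dots> = (if j \<noteq> m then real q * A j / A m + (\<tau> j - \<tau> m) / A m else 0)
          - (if i \<noteq> m then real p * A i / A m + (\<tau> i - \<tau> m) / A m else 0)"
        by (simp add: sum_subtractf sum.delta)
      finally have "(\<Sum>l\<in>I. g (i,p,j,q) l * u l) = \<dots>" .
      moreover have "A m / A m = 1" using Am by simp
      ultimately show ?thesis
        by (auto simp: f0_def add_divide_distrib diff_divide_distrib simp flip: times_divide_eq_right)
    qed
    have "order_pattern \<beta> A \<tau> = {x\<in>close_events \<beta>. f0 x + (\<Sum>l\<in>I. g x l * u l) > 0}"
      unfolding order_pattern_def using Am by (auto simp: * zero_less_divide_iff)
    then show "order_pattern \<beta> A \<tau> \<in> ?P" by blast
  qed
  have fR: "finite (close_events \<beta>)" by (rule close_events_bound) fact+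
  have fP: "finite ?P" by (rule finite_subset[of _ "Pow (close_events \<beta>)"]) (use fR in auto)
  show "finite {order_pattern \<beta> A \<tau> |A \<tau>. A m > 0}" using finite_subset[OF sub fP] .
  have "card {order_pattern \<beta> A \<tau> |A \<tau>. A m > 0} \<le> card ?P" by (rule card_mono[OF fP sub])
  also have "\<dots> \<le> (card (close_events \<beta>) + 1) ^ card I" by (rule card_sign_patterns) (use fR in \<open>auto simp: I_def\<close>)
  also have "card I = 2 * CARD('d) - 2" by (simp add: I_def card_cartesian_product card_Diff_singleton)
  also have "(card (close_events \<beta>) + 1) ^ (2 * CARD('d) - 2) \<le> (45 * CARD('d)^2 * n + 1) ^ (2 * CARD('d) - 2)"
    using close_events_bound(2)[OF assms] by (intro power_mono) auto
  finally show "card {order_pattern \<beta> A \<tau> |A \<tau>. A m > 0} \<le> (45 * CARD('d)^2 * n + 1) ^ (2 * CARD('d) - 2)" .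
qed

subsection \<open>Words as interleaved progressions\<close>

lemma fold01_eq_0_1_iff: "fold01 s \<in> {0, 1} \<longleftrightarrow> s \<in> \<int>"
proof
  assume "fold01 s \<in> {0, 1}"
  then have "s = 2 * of_int \<lfloor>(s + 1) / 2\<rfloor> \<or> s = 2 * of_int \<lfloor>(s + 1) / 2\<rfloor> + 1 \<or> s = 2 * of_int \<lfloor>(s + 1) / 2\<rfloor> - 1"
    unfolding fold01_def by auto
  then show "s \<in> \<int>" by (metis Ints_1 Ints_add Ints_diff Ints_mult Ints_numeral Ints_of_int)
next
  assume "s \<in> \<int>"
  then obtain z where z: "s = of_int z" by (auto elim: Ints_cases)
  have fl: "\<lfloor>(of_int z + 1 :: real) / 2\<rfloor> = (z + 1) div 2"
    by (metis floor_divide_of_int_eq of_int_1 of_int_add of_int_numeral)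
  show "fold01 s \<in> {0, 1}"
  proof (cases "even z")
    case True
    then obtain w where w: "z = 2 * w" by auto
    then have "(z + 1) div 2 = w" by simp
    then show ?thesis unfolding fold01_def z fl by (simp add: w)
  next
    case False
    then obtain w where w: "z = 2 * w + 1" by (auto elim: oddE)
    then have "(z + 1) div 2 = w + 1" by simp
    then show ?thesis unfolding fold01_def z fl by (simp add: w)
  qed
qed

lemma hits_face_iff: "hits_face x v t i \<longleftrightarrow> x $ i + t * v $ i \<in> \<int>"
  unfolding hits_face_def billiard_pos_def using fold01_eq_0_1_iff by simp

lemma hit_times_progression_pos:
  fixes v x a :: real
  assumes "v > 0"
  shows "\<exists>\<tau>. a \<le> \<tau> \<and> \<tau> < a + 1 / v \<and> (\<forall>t. a \<le> t \<and> x + t * v \<in> \<int> \<longleftrightarrow> (\<exists>p::nat. t = \<tau> + real p * (1 / v)))"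
proof -
  \<comment> \<open>The first integer that the coordinate meets from time \<open>a\<close>
    on.\<close>
  define c where "c = \<lceil>x + a * v\<rceil>"
  have c: "x + a * v \<le> of_int c" "of_int c < x + a * v + 1" unfolding c_def by linarith+
  have e: "(of_int c + real p - x) / v = (of_int c - x) / v + real p * (1 / v)" for p
    by (simp add: add_divide_distrib diff_divide_distrib)
  show ?thesis
  proof (intro exI[of _ "(of_int c - x) / v"] conjI allI iffI)
    show "a \<le> (of_int c - x) / v" using c assms by (simp add: field_simps)
    have "of_int c - x < (a + 1 / v) * v" using c assms by (simp add: distrib_right)
    then show "(of_int c - x) / v < a + 1 / v" using assms by (simp only: pos_divide_less_eq)
    fix t
    {
      assume t: "a \<le> t \<and> x + t * v \<in> \<int>"
      then obtain z where z: "x + t * v = of_int z" by (auto elim: Ints_cases)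
      have "a * v \<le> t * v" using t assms by simp
      then have "c \<le> z" using c z by linarith
      then have "of_int z = of_int c + real (nat (z - c))" by simp
      then have "t * v = of_int c + real (nat (z - c)) - x" using z by linarith
      then have "t = (of_int c + real (nat (z - c)) - x) / v" by (metis assms less_irrefl nonzero_eq_divide_eq)
      then show "\<exists>p::nat. t = (of_int c - x) / v + real p * (1 / v)" unfolding e by blast
    }
    {
      assume "\<exists>p::nat. t = (of_int c - x) / v + real p * (1 / v)"
      then obtain p :: nat where "t = (of_int c - x) / v + real p * (1 / v)" by blast
      then have p: "t = (of_int c + real p - x) / v" by (simp only: e)
      then have 1: "x + t * v = of_int (c + int p)" using assms by (simp add: field_simps)
      then have "a * v \<le> t * v" using c by simp
      then have "a \<le> t" using assms by simp
      moreover have "x + t * v \<in> \<int>" unfolding 1 by (rule Ints_of_int)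
      ultimately show "a \<le> t" "x + t * v \<in> \<int>" by auto
    }
  qed
qed

lemma hit_times_progression:
  fixes v x a :: real
  assumes "v \<noteq> 0"
  shows "\<exists>\<tau>. a \<le> \<tau> \<and> \<tau> < a + 1 / \<bar>v\<bar> \<and> (\<forall>t. a \<le> t \<and> x + t * v \<in> \<int> \<longleftrightarrow> (\<exists>p::nat. t = \<tau> + real p * (1 / \<bar>v\<bar>)))"
proof (cases "v > 0")
  case True
  then show ?thesis using hit_times_progression_pos[of v a x] by simp
next
  case False
  have "- x + t * (- v) \<in> \<int> \<longleftrightarrow> x + t * v \<in> \<int>" for t
    using minus_in_Ints_iff[of "x + t * v"] by (simp add: algebra_simps)
  then show ?thesis using False assms hit_times_progression_pos[of "- v" a "- x"] by auto
qed

text \<open>The bounds on \<open>\<tau> i\<close> make it the first event of letter \<open>i\<close>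
  from time \<open>a\<close> on, so \<open>p\<close> counts the earlier events of that letter. The
  last clause says that the word misses no event up to \<open>b\<close>.\<close>

definition codes_events :: "('a \<Rightarrow> real) \<Rightarrow> ('a \<Rightarrow> real) \<Rightarrow> 'a list \<Rightarrow> bool" where
  "codes_events A \<tau> w \<longleftrightarrow> (\<exists>a b s. (\<forall>i. A i > 0 \<and> a \<le> \<tau> i \<and> \<tau> i < a + A i) \<and>
     (\<forall>k. Suc k < length w \<longrightarrow> s k < s (Suc k)) \<and>
     (\<forall>k<length w. s k \<le> b \<and> (\<forall>i. (\<exists>p::nat. s k = \<tau> i + real p * A i) \<longleftrightarrow> i = w ! k)) \<and>
     (\<forall>i (p::nat). \<tau> i + real p * A i \<le> b \<longrightarrow> (\<exists>k<length w. s k = \<tau> i + real p * A i)))"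

lemma strict_mono_on_lessThanI:
  fixes s :: "nat \<Rightarrow> real"
  assumes "\<forall>k. Suc k < n \<longrightarrow> s k < s (Suc k)"
  shows "strict_mono_on {..<n} s"
proof (rule strict_mono_onI)
  fix k l assume "k \<in> {..<n}" "l \<in> {..<n}" "k < l"
  then have "k < l" "l < n" by auto
  then show "s k < s l"
  proof (induction l)
    case (Suc l)
    then show ?case using assms by (metis Suc_lessD less_antisym less_trans)
  qed simp
qed

text \<open>A coordinate with zero velocity is never hit; it is replaced by one with a period so long
  that its first event comes after the end of the word.\<close>

lemma language_codes_events:
  fixes w :: "'d::finite list"
  assumes "w \<in> billiard_language n" "n \<ge> 2"
  shows "\<exists>A \<tau>. codes_events A \<tau> w"
proof -
  obtain x v :: "real^'d" and a b s where len: "length w = n" 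
    and inc: "\<forall>k. Suc k < n \<longrightarrow> s k < s (Suc k)"
    and hits: "{t \<in> {a..b}. \<exists>i. hits_face x v t i} = s ` {..<n}"
    and lt: "\<forall>k<n. \<forall>i. hits_face x v (s k) i \<longleftrightarrow> i = w ! k"
    using assms unfolding billiard_language_def by auto
  note hit = hits[unfolded hits_face_iff] lt[unfolded hits_face_iff]
  have sab: "a \<le> s k \<and> s k \<le> b" if "k < n" for k
  proof -
    have "s k \<in> {t \<in> {a..b}. \<exists>i. hits_face x v t i}" unfolding hits using that by simp
    then show ?thesis by simp
  qed
  have s01: "s 0 < s 1" using inc assms by simp
  then have ab: "a < b" using sab[of 0] sab[of 1] assms by simp
  \<comment> \<open>A coordinate resting on a face would be hit during all of \<open>[a,b]\<close>,
    which is infinite because two distinct hits force \<open>a < b\<close>.\<close>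
  have zero: "x $ i \<notin> \<int>" if "v $ i = 0" for i
  proof
    assume "x $ i \<in> \<int>"
    then have "{a..b} \<subseteq> {t \<in> {a..b}. \<exists>i. x $ i + t * v $ i \<in> \<int>}" using that by (auto intro: exI[of _ i])
    then have "{a..b} \<subseteq> s ` {..<n}" unfolding hit(1) .
    then have "finite {a..b}" using finite_surj by blast
    then show False using infinite_Icc[OF ab] by blast
  qed
  have "\<exists>A \<tau>. A > 0 \<and> a \<le> \<tau> \<and> \<tau> < a + A \<and> (\<forall>t\<in>{a..b}. x $ i + t * v $ i \<in> \<int> \<longleftrightarrow> (\<exists>p::nat. t = \<tau> + real p * A))" for i
  proof (cases "v $ i = 0")
    case True
    have "x $ i + t * v $ i \<notin> \<int>" for t using zero True by simp
    \<comment> \<open>The offset \<open>b + 1\<close> is past the end of the segment, and the period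
      \<open>b + 2 - a\<close> is just long enough to keep it within one period after
      \<open>a\<close>.\<close>
    moreover have "t \<noteq> b + 1 + real p * (b + 2 - a)" if "t \<in> {a..b}" for t p
    proof -
      have "0 \<le> real p * (b + 2 - a)" using ab by simp
      then show ?thesis using that unfolding atLeastAtMost_iff by linarith
    qed
    ultimately show ?thesis using ab by - (rule exI[of _ "b + 2 - a"], rule exI[of _ "b + 1"], auto)
  next
    case False
    then obtain \<tau> where "a \<le> \<tau> \<and> \<tau> < a + 1 / \<bar>v $ i\<bar> \<and>
        (\<forall>t. a \<le> t \<and> x $ i + t * v $ i \<in> \<int> \<longleftrightarrow> (\<exists>p::nat. t = \<tau> + real p * (1 / \<bar>v $ i\<bar>)))"
      using hit_times_progression by blast
    moreover have "1 / \<bar>v $ i\<bar> > 0" using False by simp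
    ultimately show ?thesis by (metis atLeastAtMost_iff)
  qed
  then obtain A \<tau> where At: "\<And>i. A i > 0 \<and> a \<le> \<tau> i \<and> \<tau> i < a + A i \<and>
      (\<forall>t\<in>{a..b}. x $ i + t * v $ i \<in> \<int> \<longleftrightarrow> (\<exists>p::nat. t = \<tau> i + real p * A i))" by metis
  have "codes_events A \<tau> w"
    unfolding codes_events_def len
  proof (rule exI[of _ a], rule exI[of _ b], rule exI[of _ s], intro conjI allI impI)
    fix k i assume "k < n"
    then show "(\<exists>p::nat. s k = \<tau> i + real p * A i) \<longleftrightarrow> i = w ! k" using At hit(2) sab by auto
  next
    fix i and p :: nat assume le: "\<tau> i + real p * A i \<le> b"
    have "0 \<le> real p * A i" using At[of i] by simp
    then have "\<tau> i + real p * A i \<in> {a..b}" using le At[of i] unfolding atLeastAtMost_iff by linarith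
    then have "\<tau> i + real p * A i \<in> s ` {..<n}" using At[of i] hit(1) by blast
    then show "\<exists>k<n. s k = \<tau> i + real p * A i" by auto
  qed (use At inc sab in auto)
  then show ?thesis by blast
qed

lemma count_list_take:
  assumes "k \<le> length w"
  shows "count_list (take k w) j = card {k'. k' < k \<and> w ! k' = j}"
proof -
  have "count_list (take k w) j = card {i. i < length (take k w) \<and> j = take k w ! i}"
    by (simp only: count_list_eq_length_filter length_filter_conv_card)
  also have "{i. i < length (take k w) \<and> j = take k w ! i} = {k'. k' < k \<and> w ! k' = j}" using assms by auto
  finally show ?thesis .
qed

text \<open>\<open>T\<close> is the time of the event coded by \<open>w ! k\<close>.\<close>

lemma codes_events_prefix:
  fixes w :: "'d list"
  assumes "codes_events A \<tau> w" "k < length w"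
  defines "c \<equiv> \<lambda>i. count_list (take k w) i"
  shows "\<exists>a T. \<forall>i. A i > 0 \<and> a \<le> \<tau> i \<and> \<tau> i < a + A i \<and> T \<le> \<tau> i + real (c i) * A i \<and>
     \<tau> i + real (c i) * A i < T + A i \<and> (T = \<tau> i + real (c i) * A i \<longleftrightarrow> i = w ! k)"
proof -
  let ?n = "length w"
  obtain a b s where H: "\<forall>i. A i > 0 \<and> a \<le> \<tau> i \<and> \<tau> i < a + A i"
     "\<forall>k. Suc k < ?n \<longrightarrow> s k < s (Suc k)"
     "\<forall>k<?n. s k \<le> b \<and> (\<forall>i. (\<exists>p::nat. s k = \<tau> i + real p * A i) \<longleftrightarrow> i = w ! k)"
     "\<forall>i (p::nat). \<tau> i + real p * A i \<le> b \<longrightarrow> (\<exists>k<?n. s k = \<tau> i + real p * A i)"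
    using assms(1) unfolding codes_events_def by (elim exE conjE) (rule that)
  have At: "\<And>i. A i > 0 \<and> a \<le> \<tau> i \<and> \<tau> i < a + A i" using H(1) by blast
  have inc: "\<forall>k. Suc k < ?n \<longrightarrow> s k < s (Suc k)" by (rule H(2))
  have sb: "\<And>k. k < ?n \<Longrightarrow> s k \<le> b"
    and wk: "\<And>k i. k < ?n \<Longrightarrow> (\<exists>p::nat. s k = \<tau> i + real p * A i) \<longleftrightarrow> i = w ! k" using H(3) by simp_all
  have ex: "\<And>i (p::nat). \<tau> i + real p * A i \<le> b \<Longrightarrow> (\<exists>k<?n. s k = \<tau> i + real p * A i)" using H(4) by simp
  have sm: "strict_mono_on {..<?n} s" by (rule strict_mono_on_lessThanI) (use inc in auto)
  have inj: "inj_on s {..<?n}" using sm by (rule strict_mono_on_imp_inj_on)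
  have less: "s l < s k \<longleftrightarrow> l < k" if "l < ?n" for l
    using sm that assms(2) by (simp add: strict_mono_on_less)
  \<comment> \<open>\<open>L\<close> counts the events of \<open>j\<close> before \<open>s k\<close>
    along its progression. The same events are in bijection with the occurrences of \<open>j\<close>
    among the first \<open>k\<close> letters, hence \<open>L = c j\<close>.\<close>
  have P: "\<tau> j + real p * A j < s k \<longleftrightarrow> p < c j" for j and p :: nat
  proof -
    let ?e = "\<lambda>p::nat. \<tau> j + real p * A j"
    have mono: "?e p \<le> ?e q" if "p \<le> q" for p q using that At[of j] by simp
    have inje: "inj ?e" using At[of j] by (intro injI) simp
    define L where "L = (LEAST p. s k \<le> ?e p)"
    have "\<exists>p. s k \<le> ?e p"
    proof -
      obtain p :: nat where "(s k - \<tau> j) / A j \<le> real p" using real_arch_simple by blast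
      then show ?thesis using At[of j] by (intro exI[of _ p]) (simp add: field_simps)
    qed
    then have L: "s k \<le> ?e L" unfolding L_def by (rule LeastI_ex)
    have iff: "?e p < s k \<longleftrightarrow> p < L" for p
    proof
      assume "?e p < s k" then show "p < L" using L mono[of L p] by linarith
    next
      assume "p < L" then show "?e p < s k" unfolding L_def using not_less_Least by (meson not_le)
    qed
    have "?e ` {..<L} = s ` {k'. k' < k \<and> w ! k' = j}"
    proof (intro equalityI image_subsetI)
      fix p assume "p \<in> {..<L}"
      then have lt: "?e p < s k" using iff by simp
      then have "?e p \<le> b" using sb[OF assms(2)] by simp
      from ex[OF this] obtain l where l: "l < ?n" "s l = ?e p" by auto
      then have "l < k" using lt less[OF l(1)] by simp
      moreover have "w ! l = j" using wk[OF l(1), of j] l(2) by auto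
      ultimately have "l \<in> {k'. k' < k \<and> w ! k' = j}" by simp
      then show "?e p \<in> s ` {k'. k' < k \<and> w ! k' = j}" unfolding l(2)[symmetric] by (rule imageI)
    next
      fix l assume "l \<in> {k'. k' < k \<and> w ! k' = j}"
      then have l: "l < k" "w ! l = j" by auto
      then have ln: "l < ?n" using assms(2) by simp
      then obtain p where p: "s l = ?e p" using wk[OF ln, of j] l by blast
      have "s l < s k" using less[OF ln] l by simp
      then have "p \<in> {..<L}" using iff[of p] p by simp
      then show "s l \<in> ?e ` {..<L}" unfolding p by (rule imageI)
    qed
    then have "card (?e ` {..<L}) = card (s ` {k'. k' < k \<and> w ! k' = j})" by simp
    moreover have "card (?e ` {..<L}) = L" using inje by (simp add: card_image inj_on_subset)
    moreover have "card (s ` {k'. k' < k \<and> w ! k' = j}) = card {k'. k' < k \<and> w ! k' = j}"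
      by (rule card_image[OF inj_on_subset[OF inj]]) (use assms(2) in auto)
    ultimately have "L = c j" using assms(2) by (simp add: c_def count_list_take)
    then show ?thesis using iff by simp
  qed
  have "a \<le> s k"
  proof -
    obtain p where "s k = \<tau> (w ! k) + real p * A (w ! k)" using wk[OF assms(2)] by blast
    moreover have "0 \<le> real p * A (w ! k)" using At[of "w ! k"] by simp
    ultimately show ?thesis using At[of "w ! k"] by linarith
  qed
  show ?thesis
  proof (rule exI[of _ a], rule exI[of _ "s k"], intro allI conjI)
    fix i
    show le: "s k \<le> \<tau> i + real (c i) * A i" using P[of i "c i"] by simp
    \<comment> \<open>If \<open>i\<close> has occurred, its preceding event is before
      \<open>s k\<close>; otherwise the bound comes from \<open>\<tau> i < a + A i\<close>.\<close>
    show "\<tau> i + real (c i) * A i < s k + A i"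
    proof (cases "c i")
      case 0
      then show ?thesis using At[of i] \<open>a \<le> s k\<close> by simp
    next
      case (Suc p)
      then have "\<tau> i + real p * A i < s k" using P by simp
      then show ?thesis using Suc by (simp add: algebra_simps)
    qed
    show "s k = \<tau> i + real (c i) * A i \<longleftrightarrow> i = w ! k"
    proof
      assume "i = w ! k"
      then obtain p where p: "s k = \<tau> i + real p * A i" using wk[OF assms(2)] by blast
      have "\<not> p < c i" using P[of i p] p by simp
      then have "real (c i) * A i \<le> real p * A i" using At[of i] by simp
      then show "s k = \<tau> i + real (c i) * A i" using p le by simp
    qed (use wk[OF assms(2)] in blast)
  qed (use At in auto)
qed

section \<open>Recovering a word from its frequency cell and order pattern\<close>

text \<open>Since \<open>m\<close> occurs at most \<open>n\<close> times in the word,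
  \<open>real n * A m\<close> bounds the time elapsed from \<open>a\<close> to any of its letters;
  up to rounding, the value at \<open>i\<close> is the number of periods of \<open>i\<close> in that
  time.\<close>

definition frequency_cell :: "nat \<Rightarrow> 'a \<Rightarrow> ('a \<Rightarrow> real) \<Rightarrow> 'a \<Rightarrow> nat" where
  "frequency_cell n m A i = nat \<lfloor>real n * A m / A i\<rfloor>"

text \<open>At the time \<open>T\<close> of the current letter, the next event of each letter is
  less than one period away. Together with the bounds on the offsets this gives
  \<open>c i * A i - c j * A j < A i + A j\<close>; multiplication by
  \<open>n * A m / (A i * A j)\<close> turns periods into frequencies.\<close>

lemma codes_events_close:
  fixes w :: "'d list" and m :: 'd
  assumes "codes_events A \<tau> w" "k < length w" "n = length w"
  defines "c \<equiv> \<lambda>i. count_list (take k w) i" and "\<beta> \<equiv> frequency_cell n m A"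
  shows "(i, c i, j, c j) \<in> close_events \<beta>"
proof -
  obtain a T where E: "\<And>i. A i > 0 \<and> a \<le> \<tau> i \<and> \<tau> i < a + A i \<and> T \<le> \<tau> i + real (c i) * A i \<and>
     \<tau> i + real (c i) * A i < T + A i"
    using codes_events_prefix[OF assms(1,2)] unfolding c_def by blast
  define y where "y i = real n * A m / A i" for i
  have \<beta>: "real (\<beta> i) \<le> y i" "y i < real (\<beta> i) + 1" for i
  proof -
    have "0 \<le> y i" using E by (simp add: y_def less_imp_le)
    then show "real (\<beta> i) \<le> y i" "y i < real (\<beta> i) + 1"
      unfolding \<beta>_def frequency_cell_def y_def[symmetric] by linarith+
  qed
  \<comment> \<open>The letter at position \<open>k\<close> is not counted, so
    \<open>c m + 1 \<le> n\<close>; this pays for the offset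
    \<open>\<tau> m < a + A m\<close>.\<close>
  have "c m \<le> k" using assms(2) count_le_length[of "take k w" m] by (simp add: c_def)
  then have "real (c m) + 1 \<le> real n" using assms by simp
  then have "(real (c m) + 1) * A m \<le> real n * A m" using E[of m] by (intro mult_right_mono) auto
  then have T: "T < a + real n * A m" using E[of m] by (simp add: distrib_right)
  have c: "c i \<le> \<beta> i + 1" for i
  proof -
    have "real (c i) * A i < real n * A m + A i" using T E[of i] by linarith
    then have "real (c i) < y i + 1" using E[of i] by (simp add: y_def field_simps)
    then show ?thesis using \<beta>(2)[of i] by linarith
  qed
  have d: "real (c i) * y j - real (c j) * y i < y i + y j" if "n > 0" for i j
  proof -
    have "real (c i) * A i - real (c j) * A j < A i + A j" using E[of i] E[of j] by linarith
    then have "(real n * A m / (A i * A j)) * (real (c i) * A i - real (c j) * A j) < (real n * A m / (A i * A j)) * (A i + A j)"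
      using E[of i] E[of j] E[of m] that by (intro mult_strict_left_mono) auto
    moreover have "(real n * A m / (A i * A j)) * (real (c i) * A i - real (c j) * A j) = real (c i) * y j - real (c j) * y i"
      using E[of i] E[of j] by (simp add: y_def field_simps)
    moreover have "(real n * A m / (A i * A j)) * (A i + A j) = y i + y j"
      using E[of i] E[of j] by (simp add: y_def field_simps)
    ultimately show ?thesis by simp
  qed
  have n: "n > 0" using assms(2,3) by linarith
  \<comment> \<open>Replacing \<open>y\<close> by its integer part \<open>\<beta>\<close> costs at
    most \<open>c j \<le> \<beta> j + 1\<close> in the product and one for each of
    \<open>y i\<close> and \<open>y j\<close>; this is the origin of the slack 3 in
    \<open>close_events\<close>.\<close>
  have "int (c i) * int (\<beta> j) - int (c j) * int (\<beta> i) \<le> 2 * (int (\<beta> i) + int (\<beta> j)) + 3" for i j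
  proof -
    have "real (c i) * real (\<beta> j) \<le> real (c i) * y j" using \<beta> by (intro mult_left_mono) auto
    moreover have "real (c j) * y i \<le> real (c j) * (real (\<beta> i) + 1)" using \<beta>(2)[of i] by (intro mult_left_mono) auto
    ultimately have "real (c i) * real (\<beta> j) - real (c j) * real (\<beta> i) < 2 * real (\<beta> j) + real (\<beta> i) + 3"
      using d[of i j] n c[of j] \<beta>(2)[of i] \<beta>(2)[of j] by (simp add: distrib_left)
    then have "real_of_int (int (c i) * int (\<beta> j) - int (c j) * int (\<beta> i)) < real_of_int (2 * int (\<beta> j) + int (\<beta> i) + 3)" by simp
    then have "int (c i) * int (\<beta> j) - int (c j) * int (\<beta> i) < 2 * int (\<beta> j) + int (\<beta> i) + 3" by (simp only: of_int_less_iff)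
    then show ?thesis by simp
  qed
  from this[of i j] this[of j i] show ?thesis using c by (auto simp: close_events_def)
qed

text \<open>At a first difference both words have the same prefix counts and so compare the same two
  next events. Each word puts its own letter strictly first, contradicting the common order
  pattern.\<close>

lemma codes_events_determined:
  fixes w w' :: "'d list"
  assumes w: "codes_events A \<tau> w" "length w = n" and w': "codes_events A' \<tau>' w'" "length w' = n"
    and cell: "frequency_cell n m A = \<beta>" "frequency_cell n m A' = \<beta>"
    and pat: "order_pattern \<beta> A \<tau> = order_pattern \<beta> A' \<tau>'"
  shows "w = w'"
proof -
  have "k \<le> n \<Longrightarrow> take k w = take k w'" for k
  proof (induction k)
    case (Suc k)
    then have k: "k < length w" "k < length w'" and eq: "take k w = take k w'" using w w' by auto
    let ?c = "\<lambda>i. count_list (take k w) i"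
    have "w ! k = w' ! k"
    proof (rule ccontr)
      assume ne: "w ! k \<noteq> w' ! k"
      let ?i = "w ! k" and ?j = "w' ! k"
      have "\<tau> ?i + real (?c ?i) * A ?i < \<tau> ?j + real (?c ?j) * A ?j"
        using codes_events_prefix[OF w(1) k(1)] ne by (metis order_le_less)
      then have "(?i, ?c ?i, ?j, ?c ?j) \<in> order_pattern \<beta> A \<tau>"
        using codes_events_close[OF w(1) k(1) w(2)[symmetric], of ?i ?j m] cell by (auto simp: order_pattern_def)
      then have "(?i, ?c ?i, ?j, ?c ?j) \<in> order_pattern \<beta> A' \<tau>'" using pat by simp
      then have "\<tau>' ?i + real (?c ?i) * A' ?i < \<tau>' ?j + real (?c ?j) * A' ?j" by (auto simp: order_pattern_def)
      moreover have "\<tau>' ?j + real (?c ?j) * A' ?j < \<tau>' ?i + real (?c ?i) * A' ?i"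
        using codes_events_prefix[OF w'(1) k(2)] ne eq by (metis order_le_less)
      ultimately show False by simp
    qed
    then show ?case using eq k by (simp add: take_Suc_conv_app_nth)
  qed simp
  from this[of n] show ?thesis using w w' by simp
qed

section \<open>The upper bound on the number of words\<close>

lemma card_functions_fixed_value:
  "card {\<beta> :: 'd::finite \<Rightarrow> nat. (\<forall>i. \<beta> i \<le> n) \<and> \<beta> m = n} \<le> (n + 1) ^ (CARD('d) - 1)"
  "finite {\<beta> :: 'd::finite \<Rightarrow> nat. (\<forall>i. \<beta> i \<le> n) \<and> \<beta> m = n}"
proof -
  let ?E = "PiE (UNIV - {m}) (\<lambda>_. {..n})"
  have fE: "finite ?E" by (intro finite_PiE) auto
  have sub: "{\<beta> :: 'd::finite \<Rightarrow> nat. (\<forall>i. \<beta> i \<le> n) \<and> \<beta> m = n} \<subseteq> (\<lambda>f. f(m := n)) ` ?E"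
  proof
    fix \<beta> assume b: "\<beta> \<in> {\<beta> :: 'd::finite \<Rightarrow> nat. (\<forall>i. \<beta> i \<le> n) \<and> \<beta> m = n}"
    then have "restrict \<beta> (UNIV - {m}) \<in> ?E" by auto
    moreover have "\<beta> = (restrict \<beta> (UNIV - {m}))(m := n)" using b by (auto simp: fun_eq_iff)
    ultimately show "\<beta> \<in> (\<lambda>f. f(m := n)) ` ?E" by blast
  qed
  show "finite {\<beta> :: 'd::finite \<Rightarrow> nat. (\<forall>i. \<beta> i \<le> n) \<and> \<beta> m = n}" using finite_subset[OF sub] fE by blast
  have "card {\<beta> :: 'd::finite \<Rightarrow> nat. (\<forall>i. \<beta> i \<le> n) \<and> \<beta> m = n} \<le> card ?E"
    using card_mono[OF _ sub] card_image_le[OF fE, of "\<lambda>f. f(m := n)"] fE by (meson finite_imageI order_trans)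
  also have "\<dots> = (n + 1) ^ (CARD('d) - 1)" by (simp add: card_PiE card_Diff_singleton)
  finally show "card {\<beta> :: 'd::finite \<Rightarrow> nat. (\<forall>i. \<beta> i \<le> n) \<and> \<beta> m = n} \<le> (n + 1) ^ (CARD('d) - 1)" .
qed

text \<open>The three factors count the codes \<open>\<Phi> w\<close>: the fastest letter, the cell,
  whose value at that letter is always \<open>n\<close>, and the order pattern.\<close>

lemma card_language_le:
  assumes "n \<ge> 2"
  shows "card (billiard_language n :: 'd::finite list set)
    \<le> CARD('d) * (n + 1) ^ (CARD('d) - 1) * (45 * CARD('d)^2 * n + 1) ^ (2 * CARD('d) - 2)"
proof -
  let ?L = "billiard_language n :: 'd list set"
  define B where "B m = {\<beta> :: 'd \<Rightarrow> nat. (\<forall>i. \<beta> i \<le> n) \<and> \<beta> m = n}" for m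
  define F where "F m \<beta> = {order_pattern \<beta> A \<tau> |A \<tau>. A m > 0}" for m :: 'd and \<beta>
  have len: "length w = n" if "w \<in> ?L" for w using that by (auto simp: billiard_language_def)
  have "\<exists>A \<tau> m. codes_events A \<tau> w \<and> (\<forall>i. A m \<le> A i)" if "w \<in> ?L" for w
  proof -
    obtain A \<tau> where "codes_events A \<tau> w" using language_codes_events[OF \<open>w \<in> ?L\<close> assms] by blast
    moreover obtain m where "\<forall>i. A m \<le> A i"
      using ex_min_if_finite[of "range A"] by (metis (mono_tags, lifting) finite_class.finite_UNIV finite_imageI image_is_empty not_less rangeE rangeI UNIV_not_empty)
    ultimately show ?thesis by blast
  qed
  then obtain A \<tau> m where c: "\<And>w. w \<in> ?L \<Longrightarrow> codes_events (A w) (\<tau> w) w \<and> (\<forall>i. A w (m w) \<le> A w i)" by metis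
  have pos: "A w i > 0" if "w \<in> ?L" for w i using c[OF that] unfolding codes_events_def by blast
  define \<Phi> where "\<Phi> w = (m w, frequency_cell n (m w) (A w), order_pattern (frequency_cell n (m w) (A w)) (A w) (\<tau> w))" for w
  have inj: "inj_on \<Phi> ?L"
  proof (rule inj_onI)
    fix w w' assume w: "w \<in> ?L" "w' \<in> ?L" "\<Phi> w = \<Phi> w'"
    then show "w = w'" using c[OF w(1)] c[OF w(2)] len[OF w(1)] len[OF w(2)]
      by (intro codes_events_determined[of "A w" "\<tau> w" w n "A w'" "\<tau> w'" w' "m w" "frequency_cell n (m w) (A w)"]) (auto simp: \<Phi>_def)
  qed
  let ?S = "SIGMA m:UNIV. SIGMA \<beta>:B m. F m \<beta>"
  have sub: "\<Phi> ` ?L \<subseteq> ?S"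
  proof (rule image_subsetI)
    fix w assume w: "w \<in> ?L"
    have "frequency_cell n (m w) (A w) i \<le> n" for i
    proof -
      have "real n * A w (m w) / A w i \<le> real n"
        using c[OF w] pos[OF w] by (simp add: pos_divide_le_eq mult_left_mono)
      then show ?thesis unfolding frequency_cell_def by linarith
    qed
    moreover have "frequency_cell n (m w) (A w) (m w) = n" using pos[OF w, of "m w"] by (simp add: frequency_cell_def)
    moreover have "order_pattern \<beta> (A w) (\<tau> w) \<in> F (m w) \<beta>" for \<beta> using pos[OF w] by (auto simp: F_def)
    ultimately show "\<Phi> w \<in> ?S" by (auto simp: \<Phi>_def B_def)
  qed
  have fF: "finite (F m \<beta>)" and cF: "card (F m \<beta>) \<le> (45 * CARD('d)^2 * n + 1) ^ (2 * CARD('d) - 2)"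
    if "\<beta> \<in> B m" for m \<beta>
    using card_order_patterns[of \<beta> n m] that assms by (auto simp: F_def B_def)
  have fB: "finite (B m)" for m unfolding B_def by (rule card_functions_fixed_value)
  have fS: "finite (SIGMA \<beta>:B m. F m \<beta>)" for m using fB fF by (rule finite_SigmaI)
  have "card ?L = card (\<Phi> ` ?L)" using inj by (simp add: card_image)
  also have "\<dots> \<le> card ?S" by (rule card_mono[OF _ sub]) (intro finite_SigmaI fS finite_class.finite_UNIV)
  also have "\<dots> = (\<Sum>m\<in>UNIV. card (SIGMA \<beta>:B m. F m \<beta>))" using fS by simp
  also have "\<dots> = (\<Sum>m\<in>UNIV. \<Sum>\<beta>\<in>B m. card (F m \<beta>))" using fB fF by simp
  also have "\<dots> \<le> (\<Sum>m\<in>(UNIV::'d set). \<Sum>\<beta>\<in>B m. (45 * CARD('d)^2 * n + 1) ^ (2 * CARD('d) - 2))"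
    by (intro sum_mono cF)
  also have "\<dots> = (\<Sum>m\<in>(UNIV::'d set). card (B m)) * (45 * CARD('d)^2 * n + 1) ^ (2 * CARD('d) - 2)"
    by (simp add: sum_distrib_right)
  also have "\<dots> \<le> (\<Sum>m\<in>(UNIV::'d set). (n + 1) ^ (CARD('d) - 1)) * (45 * CARD('d)^2 * n + 1) ^ (2 * CARD('d) - 2)"
    unfolding B_def by (intro mult_right_mono sum_mono card_functions_fixed_value) auto
  finally show ?thesis by simp
qed

lemma card_language_upper:
  assumes "n \<ge> 1"
  shows "card (billiard_language n :: 'd::finite list set)
    \<le> CARD('d) * 2 ^ (CARD('d) - 1) * (46 * CARD('d)^2) ^ (2 * CARD('d) - 2) * n ^ (3 * CARD('d) - 3)"
proof (cases "n = 1")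
  \<comment> \<open>Length one is treated apart: the passage to progressions uses two hits to ensure
    a segment of positive length.\<close>
  case True
  have "(billiard_language 1 :: 'd list set) \<subseteq> {w. set w \<subseteq> UNIV \<and> length w = 1}" by (auto simp: billiard_language_def)
  then have "card (billiard_language 1 :: 'd list set) \<le> card {w. set w \<subseteq> (UNIV::'d set) \<and> length w = 1}"
    by (intro card_mono finite_lists_length_eq) auto
  also have "\<dots> = CARD('d) * 1 * 1" by (subst card_lists_length_eq) auto
  also have "\<dots> \<le> CARD('d) * 2 ^ (CARD('d) - 1) * (46 * CARD('d)^2) ^ (2 * CARD('d) - 2)"
    by (intro mult_mono) auto
  finally show ?thesis using True by simp
next
  case False
  let ?d = "CARD('d)"
  have "?d^2 * n \<ge> 1" using assms by simp
  then have N: "45 * ?d^2 * n + 1 \<le> 46 * ?d^2 * n" by linarith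
  have "card (billiard_language n :: 'd::finite list set) \<le> ?d * (n + 1) ^ (?d - 1) * (45 * ?d^2 * n + 1) ^ (2 * ?d - 2)"
    by (rule card_language_le) (use assms False in auto)
  also have "\<dots> \<le> ?d * (2 * n) ^ (?d - 1) * (46 * ?d^2 * n) ^ (2 * ?d - 2)"
    by (intro mult_mono power_mono N) (use assms in auto)
  also have "\<dots> = ?d * 2 ^ (?d - 1) * (46 * ?d^2) ^ (2 * ?d - 2) * (n ^ (?d - 1) * n ^ (2 * ?d - 2))"
    by (simp only: power_mult_distrib mult_ac)
  also have "n ^ (?d - 1) * n ^ (2 * ?d - 2) = n ^ (3 * ?d - 3)"
    unfolding power_add[symmetric] by (rule arg_cong[where f="\<lambda>k. n ^ k"]) simp
  finally show ?thesis .
qed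

subsection \<open>Digitized lines\<close>

text \<open>A telescoping bound with equality at \<open>Q = 2\<close>. Starting the sum at 2 keeps
  it below 1, as the sieve for coprime pairs requires.\<close>

lemma sum_inverse_squares_le:
  "Q \<ge> 2 \<Longrightarrow> (\<Sum>g = 2..Q. 1 / (real g)^2) \<le> 3 / 4 - 1 / real Q"
proof (induction Q rule: dec_induct)
  case (step Q)
  have "1 / (real (Suc Q))^2 \<le> 1 / (real Q * real (Suc Q))"
    using step by (intro divide_left_mono) (auto simp: power2_eq_square)
  also have "\<dots> = 1 / real Q - 1 / real (Suc Q)" using step by (simp add: field_simps)
  finally show ?case using step by simp
qed (simp add: power2_eq_square)

text \<open>A pair with common divisor \<open>g \<ge> 2\<close> is one of at most
  \<open>(Q / g)^2\<close> multiples of \<open>g\<close>. Summed over \<open>g\<close> this removes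
  at most three quarters of the square.\<close>

lemma card_coprime_pairs:
  "4 * card {(p, q). p \<in> {1..Q} \<and> q \<in> {1..Q} \<and> coprime p q} \<ge> Q^2" for Q :: nat
proof (cases "Q \<ge> 2")
  case False
  then consider "Q = 0" | "Q = 1" by linarith
  then show ?thesis
  proof cases
    case 2
    have "{(p, q). p \<in> {1..1::nat} \<and> q \<in> {1..1::nat} \<and> coprime p q} = {(1,1)}" by auto
    then show ?thesis unfolding 2 by simp
  qed simp
next
  case True
  define U where "U = {1..Q} \<times> {1..Q}"
  define C where "C = {(p, q). p \<in> {1..Q} \<and> q \<in> {1..Q} \<and> coprime p q}"
  define M where "M g = (\<lambda>(a, b). (g * a, g * b)) ` ({1..Q div g} \<times> {1..Q div g})" for g
  have "U - C \<subseteq> (\<Union>g\<in>{2..Q}. M g)"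
  proof
    fix z assume z: "z \<in> U - C"
    obtain p q where zpq: "z = (p, q)" by (cases z)
    have pq: "1 \<le> p" "p \<le> Q" "1 \<le> q" "q \<le> Q" "\<not> coprime p q"
      using z by (auto simp: zpq U_def C_def)
    define g where "g = gcd p q"
    have "g \<noteq> 1" using pq by (auto simp: g_def coprime_iff_gcd_eq_1)
    moreover have "g \<noteq> 0" using pq by (simp add: g_def)
    moreover have "g \<le> p" using pq by (auto simp: g_def intro: dvd_imp_le)
    ultimately have g: "g \<in> {2..Q}" using pq by auto
    obtain a b where ab: "p = g * a" "q = g * b" unfolding g_def by (meson dvdE gcd_dvd1 gcd_dvd2)
    have "a \<le> Q div g" "b \<le> Q div g" using ab pq g by (auto simp: less_eq_div_iff_mult_less_eq mult.commute)
    moreover have "1 \<le> a" "1 \<le> b" using ab pq by (auto simp: Suc_le_eq intro: Nat.gr0I)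
    ultimately have "z \<in> M g" unfolding M_def zpq ab by (intro image_eqI[of _ _ "(a, b)"]) auto
    then show "z \<in> (\<Union>g\<in>{2..Q}. M g)" using g by blast
  qed
  then have "card (U - C) \<le> card (\<Union>g\<in>{2..Q}. M g)" by (intro card_mono) (auto simp: M_def)
  also have "\<dots> \<le> (\<Sum>g\<in>{2..Q}. card (M g))" by (rule card_UN_le) auto
  also have "\<dots> \<le> (\<Sum>g\<in>{2..Q}. (Q div g)^2)"
  proof (rule sum_mono)
    fix g
    have "card (M g) \<le> card ({1..Q div g} \<times> {1..Q div g})" unfolding M_def by (rule card_image_le) auto
    then show "card (M g) \<le> (Q div g)^2" by (simp add: card_cartesian_product power2_eq_square)
  qed
  finally have "real (card (U - C)) \<le> real (\<Sum>g\<in>{2..Q}. (Q div g)^2)" by (simp only: of_nat_le_iff)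
  also have "\<dots> \<le> (\<Sum>g\<in>{2..Q}. (real Q)^2 * (1 / (real g)^2))"
  proof -
    have "real ((Q div g)^2) \<le> (real Q)^2 * (1 / (real g)^2)" for g
    proof -
      have "(real (Q div g))^2 \<le> (real Q / real g)^2" by (intro power_mono of_nat_div_le_of_nat) auto
      then show ?thesis by (simp add: power_divide)
    qed
    then show ?thesis unfolding of_nat_sum by (rule sum_mono)
  qed
  also have "\<dots> = (real Q)^2 * (\<Sum>g = 2..Q. 1 / (real g)^2)" by (simp only: sum_distrib_left)
  also have "\<dots> \<le> (real Q)^2 * (3 / 4)"
  proof (rule mult_left_mono)
    have "0 \<le> 1 / real Q" by simp
    then show "(\<Sum>g = 2..Q. 1 / (real g)^2) \<le> 3 / 4" using sum_inverse_squares_le[OF True] by linarith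
  qed simp
  finally have "real (4 * card (U - C)) \<le> real (3 * Q^2)" by simp
  then have "4 * card (U - C) \<le> 3 * Q^2" by (simp only: of_nat_le_iff)
  moreover have "card U = card (U - C) + card C"
  proof -
    have "C \<subseteq> U" "finite U" by (auto simp: C_def U_def)
    then show ?thesis by (metis add.commute card_Diff_subset card_mono finite_subset le_add_diff_inverse)
  qed
  moreover have "card U = Q^2" by (simp add: U_def card_cartesian_product power2_eq_square)
  ultimately have "Q^2 = card (U - C) + card C" "4 * card (U - C) \<le> 3 * Q^2"
    by simp_all
  then have "Q^2 \<le> 4 * card C" by linarith
  then show ?thesis unfolding C_def .
qed

text \<open>The triple \<open>(p,q,k)\<close> encodes the digital line of slope \<open>p/q\<close> and intercept slightly above
  \<open>k/q\<close>; the lower bound on \<open>q\<close> keeps the slope below \<open>8\<close>.\<close>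

definition line_params :: "nat \<Rightarrow> (nat \<times> nat \<times> nat) set" where
  "line_params Q = {(p, q, k). p \<in> {1..Q} \<and> q \<in> {1..Q} \<and> coprime p q \<and> Q < 8 * q \<and> k < q}"

fun digital_line :: "nat \<times> nat \<times> nat \<Rightarrow> nat \<Rightarrow> nat" where
  "digital_line (p, q, k) t = (t * p + k) div q"

text \<open>Of at least \<open>Q^2 / 4\<close> coprime pairs, the requirement
  \<open>Q < 8 * q\<close> discards at most \<open>Q^2 / 8\<close>. Each remaining pair admits
  \<open>q > Q / 8\<close> intercepts.\<close>

lemma card_line_params: "finite (line_params Q)" "64 * card (line_params Q) \<ge> Q^3"
proof -
  define C where "C = {(p, q). p \<in> {1..Q} \<and> q \<in> {1..Q} \<and> coprime p q}"
  define D where "D = {(p, q). p \<in> {1..Q} \<and> q \<in> {1..Q} \<and> coprime p q \<and> Q < 8 * q}"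
  show fin: "finite (line_params Q)"
    by (rule finite_subset[of _ "{1..Q} \<times> {1..Q} \<times> {..Q}"]) (auto simp: line_params_def)
  have fD: "finite D" by (rule finite_subset[of _ "{1..Q} \<times> {1..Q}"]) (auto simp: D_def)
  have "C \<subseteq> D \<union> {1..Q} \<times> {1..Q div 8}" by (auto simp: C_def D_def)
  then have "card C \<le> card (D \<union> {1..Q} \<times> {1..Q div 8})" using fD by (intro card_mono) auto
  also have "\<dots> \<le> card D + card ({1..Q} \<times> {1..Q div 8})" by (rule card_Un_le)
  also have "\<dots> = card D + Q * (Q div 8)" by (simp add: card_cartesian_product)
  finally have "8 * card C \<le> 8 * card D + Q * (8 * (Q div 8))" by simp
  also have "\<dots> \<le> 8 * card D + Q * Q" by (intro add_mono mult_le_mono) auto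
  finally have "8 * card C \<le> 8 * card D + Q * Q" .
  then have D: "Q * Q \<le> 8 * card D"
    using card_coprime_pairs[of Q] unfolding C_def[symmetric] power2_eq_square by linarith
  have "line_params Q = (\<lambda>((p, q), k). (p, q, k)) ` (SIGMA z:D. {..<snd z})"
    by (auto simp: line_params_def D_def image_iff)
  moreover have "inj_on (\<lambda>((p, q), k). (p, q, k)) (SIGMA z:D. {..<snd z})" by (auto simp: inj_on_def)
  ultimately have "card (line_params Q) = card (SIGMA z:D. {..<snd z})" by (simp add: card_image)
  also have "\<dots> = (\<Sum>z\<in>D. snd z)" using fD by simp
  finally have "8 * card (line_params Q) = (\<Sum>z\<in>D. 8 * snd z)" by (simp add: sum_distrib_left)
  moreover have "(\<Sum>z\<in>D. Q) \<le> (\<Sum>z\<in>D. 8 * snd z)" by (rule sum_mono) (auto simp: D_def)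
  ultimately have "Q * card D \<le> 8 * card (line_params Q)" by (simp add: mult.commute)
  moreover have "Q^3 \<le> 8 * (Q * card D)" using mult_le_mono2[OF D, of Q] by (simp only: power3_eq_cube mult_ac)
  ultimately show "64 * card (line_params Q) \<ge> Q^3" by linarith
qed

text \<open>Multiplication by \<open>p\<close> is injective modulo \<open>q\<close>, so
  \<open>q\<close> consecutive times produce \<open>q\<close> distinct residues.\<close>

lemma residue_in_window:
  fixes p q :: nat
  assumes "coprime p q" "r < q"
  shows "\<exists>t. s \<le> t \<and> t < s + q \<and> (t * p + k) mod q = r"
proof -
  let ?f = "\<lambda>t. (t * p + k) mod q"
  have inj: "t = t'" if "t \<in> {s..<s + q}" "t' \<in> {s..<s + q}" "?f t = ?f t'" "t \<le> t'" for t t'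
  proof (rule ccontr)
    assume "t \<noteq> t'"
    have "q dvd (t' * p + k) - (t * p + k)" using that by (metis add_le_mono1 mod_eq_dvd_iff_nat mult_le_mono1)
    then have "q dvd (t' - t) * p" by (simp add: diff_mult_distrib)
    then have "q dvd t' - t" using assms(1) by (metis coprime_commute coprime_dvd_mult_left_iff)
    then have "q \<le> t' - t" using that \<open>t \<noteq> t'\<close> by (intro dvd_imp_le) auto
    then show False using that assms(2) by auto
  qed
  then have "inj_on ?f {s..<s + q}" unfolding inj_on_def by (metis nat_le_linear)
  then have "card (?f ` {s..<s + q}) = q" by (simp add: card_image)
  moreover have "?f ` {s..<s + q} \<subseteq> {..<q}" using assms(2) by auto
  ultimately have "?f ` {s..<s + q} = {..<q}" by (intro card_subset_eq) auto
  then have "r \<in> ?f ` {s..<s + q}" using assms(2) by simp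
  then show ?thesis by auto
qed

text \<open>Within a period of the first line there are an early time at which it is as low as possible
  above its digitization, and a late one at which it is as high as possible. A steeper second
  line cannot have the same digitization at both times.\<close>

lemma digital_line_slope_le:
  assumes a: "(p, q, k) \<in> line_params Q" and b: "(p', q', k') \<in> line_params Q"
    and eq: "\<And>t. t \<le> 3 * Q \<Longrightarrow> digital_line (p, q, k) t = digital_line (p', q', k') t"
  shows "p' * q \<le> p * q'"
proof (rule ccontr)
  assume "\<not> p' * q \<le> p * q'"
  then have slope: "p * q' + 1 \<le> p' * q" by simp
  have q: "1 \<le> q" "q \<le> Q" "coprime p q" "1 \<le> q'" "q' \<le> Q" using a b by (auto simp: line_params_def)
  obtain t1 where t1: "t1 < q" "(t1 * p + k) mod q = 0" using residue_in_window[of p q 0 0 k] q by auto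
  \<comment> \<open>Starting at \<open>2 * Q\<close> makes \<open>t2 - t1\<close> exceed
    \<open>Q \<ge> q'\<close>, while \<open>t2 < 3 * Q\<close> stays in the range where the lines
    agree.\<close>
  obtain t2 where t2: "2 * Q \<le> t2" "t2 < 2 * Q + q" "(t2 * p + k) mod q = q - 1"
    using residue_in_window[of p q "q - 1" "2 * Q" k] q by auto
  define S1 where "S1 = digital_line (p, q, k) t1"
  define S2 where "S2 = digital_line (p, q, k) t2"
  have S': "S1 = (t1 * p' + k') div q'" "S2 = (t2 * p' + k') div q'" using eq[of t1] eq[of t2] t1 t2 q by (auto simp: S1_def S2_def)
  have e1: "t1 * p + k = q * S1"
    using t1(2) mult_div_mod_eq[of q "t1 * p + k"] by (simp add: S1_def)
  have e2: "t2 * p + k = q * S2 + (q - 1)"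
    using t2(3) mult_div_mod_eq[of q "t2 * p + k"] by (simp add: S2_def)
  have e3: "q' * S1 \<le> t1 * p' + k'" unfolding S' by simp
  have e4: "t2 * p' + k' + 1 \<le> q' * S2 + q'"
    using dividend_less_times_div[of q' "t2 * p' + k'"] q unfolding S' by simp
  define I where "I = (int t2 - int t1)"
  have I: "I > int q'" using t1 t2 q by (simp add: I_def)
  have f1: "I * int p = int q * (int S2 - int S1) + (int q - 1)"
  proof -
    have "int t1 * int p + int k = int q * int S1" using e1 by (metis of_nat_add of_nat_mult)
    moreover have "int t2 * int p + int k = int q * int S2 + (int q - 1)" using e2 q by (metis of_nat_add of_nat_mult of_nat_diff of_nat_1)
    ultimately show ?thesis by (simp add: I_def algebra_simps)
  qed
  have f2: "I * int p' \<le> int q' * (int S2 - int S1) + (int q' - 1)"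
  proof -
    have "int q' * int S1 \<le> int t1 * int p' + int k'" using e3 by (metis of_nat_add of_nat_mult of_nat_le_iff)
    moreover have "int t2 * int p' + int k' + 1 \<le> int q' * int S2 + int q'" using e4 by (metis of_nat_add of_nat_mult of_nat_le_iff of_nat_1)
    ultimately show ?thesis by (simp add: I_def algebra_simps)
  qed
  \<comment> \<open>Different slopes differ by at least \<open>1 / (q * q')\<close>. Over the time
    \<open>I\<close> this lead amounts to \<open>I\<close> units of size
    \<open>1 / (q * q')\<close>, but the common digitization leaves room for only
    \<open>q' - q\<close> of them.\<close>
  have "I * (int p * int q' + 1) \<le> I * (int p' * int q)"
    using slope I by (intro mult_left_mono) (auto simp flip: of_nat_mult)
  moreover have "int q * (I * int p') \<le> int q * (int q' * (int S2 - int S1) + (int q' - 1))"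
    using f2 by (rule mult_left_mono) simp
  moreover have "int q' * (I * int p) = int q' * (int q * (int S2 - int S1) + (int q - 1))" using f1 by simp
  ultimately have "I \<le> int q' - int q" by (simp add: algebra_simps)
  then show False using I by simp
qed

text \<open>At a time with residue \<open>q - 1\<close>, raising the intercept by a single unit
  already carries into the next integer.\<close>

lemma digital_line_intercept_le:
  assumes a: "(p, q, k) \<in> line_params Q" and b: "(p, q, k') \<in> line_params Q"
    and eq: "\<And>t. t \<le> 3 * Q \<Longrightarrow> digital_line (p, q, k) t = digital_line (p, q, k') t"
  shows "k' \<le> k"
proof (rule ccontr)
  assume "\<not> k' \<le> k"
  have q: "1 \<le> q" "q \<le> Q" "coprime p q" using a by (auto simp: line_params_def)
  obtain t where t: "t < q" "(t * p + k) mod q = q - 1" using residue_in_window[of p q "q - 1" 0 k] q by auto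
  have "t * p + k = q * ((t * p + k) div q) + (q - 1)" using t(2) mult_div_mod_eq[of q "t * p + k"] by simp
  then have "(t * p + k) + 1 = q * ((t * p + k) div q + 1)" using q by simp
  then have "((t * p + k) div q + 1) * q \<le> t * p + k'" using \<open>\<not> k' \<le> k\<close> by (simp add: mult.commute)
  then have "(t * p + k) div q + 1 \<le> (t * p + k') div q" using q by (simp add: less_eq_div_iff_mult_less_eq)
  then show False using eq[of t] t q by simp
qed

lemma digital_line_inject:
  assumes "z \<in> line_params Q" "z' \<in> line_params Q"
    and eq: "\<And>t. t \<le> 3 * Q \<Longrightarrow> digital_line z t = digital_line z' t"
  shows "z = z'"
proof -
  obtain p q k p' q' k' where z: "z = (p, q, k)" "z' = (p', q', k')" by (metis prod_cases3)
  have "p' * q \<le> p * q'" by (rule digital_line_slope_le) (use assms z in auto)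
  moreover have "p * q' \<le> p' * q" by (rule digital_line_slope_le) (use assms z in auto)
  ultimately have "p * q' = p' * q" by simp
  moreover have "coprime p q" "coprime p' q'" using assms z by (auto simp: line_params_def)
  ultimately have pq: "p = p'" "q = q'" using coprime_crossproduct_nat[of p q p' q'] by simp_all
  have "k' \<le> k" by (rule digital_line_intercept_le) (use assms z pq in auto)
  moreover have "k \<le> k'" by (rule digital_line_intercept_le) (use assms z pq in auto)
  ultimately show ?thesis using z pq by simp
qed

subsection \<open>Trajectories with independent coordinates\<close>

text \<open>Values are chosen one at a time; each has only the countably many rational translates of
  the earlier ones to avoid. As time offsets of coordinates with rational speeds they rule out
  simultaneous hits.\<close>

lemma rationally_generic_points:
  fixes l u :: "'a \<Rightarrow> real"
  assumes "finite F" "m \<notin> F" "\<And>i. i \<in> F \<Longrightarrow> l i < u i"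
  shows "\<exists>\<sigma>. \<sigma> m = 0 \<and> (\<forall>i\<in>F. l i < \<sigma> i \<and> \<sigma> i < u i) \<and>
    (\<forall>i\<in>insert m F. \<forall>j\<in>insert m F. i \<noteq> j \<longrightarrow> \<sigma> i - \<sigma> j \<notin> \<rat>)"
  using assms
proof (induction F rule: finite_induct)
  case empty
  show ?case by (intro exI[of _ "\<lambda>_. 0"]) auto
next
  case (insert x F)
  then obtain \<sigma> where \<sigma>: "\<sigma> m = 0" "\<forall>i\<in>F. l i < \<sigma> i \<and> \<sigma> i < u i"
    "\<forall>i\<in>insert m F. \<forall>j\<in>insert m F. i \<noteq> j \<longrightarrow> \<sigma> i - \<sigma> j \<notin> \<rat>" by auto
  define B where "B = (\<Union>i\<in>insert m F. (\<lambda>r. \<sigma> i + r) ` \<rat>)"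
  have "countable B" unfolding B_def using insert.hyps by (intro countable_UN countable_image countable_rat) (simp add: countable_finite)
  moreover have "uncountable {l x<..<u x}" using insert.prems by (simp add: uncountable_open_interval)
  ultimately obtain y where y: "y \<in> {l x<..<u x}" "y \<notin> B" by (meson countable_subset subsetI)
  have yB: "y - \<sigma> i \<notin> \<rat>" "\<sigma> i - y \<notin> \<rat>" if "i \<in> insert m F" for i
  proof -
    show 1: "y - \<sigma> i \<notin> \<rat>"
    proof
      assume "y - \<sigma> i \<in> \<rat>"
      then have "\<sigma> i + (y - \<sigma> i) \<in> (\<lambda>r. \<sigma> i + r) ` \<rat>" by (rule imageI)
      then show False using y(2) that unfolding B_def by auto
    qed
    show "\<sigma> i - y \<notin> \<rat>" using 1 Rats_minus_iff[of "y - \<sigma> i"] by simp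
  qed
  have "x \<notin> insert m F" using insert by auto
  moreover have "y \<notin> \<rat>" using yB(1)[of m] \<sigma>(1) by simp
  ultimately show ?case using \<sigma> y(1) yB by (intro exI[of _ "\<sigma>(x := y)"]) auto
qed

lemma card_hits_before:
  fixes x u T :: real
  assumes "u > 0" "T \<ge> 0"
  defines "H \<equiv> {t. 0 \<le> t \<and> t < T \<and> x + t * u \<in> \<int>}"
  shows "finite H" "card H = nat (\<lceil>x + T * u\<rceil> - \<lceil>x\<rceil>)"
proof -
  let ?f = "\<lambda>z::int. (of_int z - x) / u"
  have H: "H = ?f ` {\<lceil>x\<rceil>..<\<lceil>x + T * u\<rceil>}"
  proof (intro equalityI subsetI)
    fix t assume t: "t \<in> H"
    then obtain z where z: "x + t * u = of_int z" by (auto simp: H_def elim: Ints_cases)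
    have "0 \<le> t * u" "t * u < T * u" using t assms by (auto simp: H_def)
    then have "x \<le> of_int z" "of_int z < x + T * u" using z by linarith+
    then have "z \<in> {\<lceil>x\<rceil>..<\<lceil>x + T * u\<rceil>}" by (simp add: ceiling_le_iff less_ceiling_iff)
    moreover have "t = ?f z" using assms by (simp flip: z)
    ultimately show "t \<in> ?f ` {\<lceil>x\<rceil>..<\<lceil>x + T * u\<rceil>}" by blast
  next
    fix t assume "t \<in> ?f ` {\<lceil>x\<rceil>..<\<lceil>x + T * u\<rceil>}"
    then obtain z where z: "t = ?f z" "z \<in> {\<lceil>x\<rceil>..<\<lceil>x + T * u\<rceil>}" by (rule imageE)
    then have "x \<le> of_int z" "of_int z < x + T * u" by (auto simp: ceiling_le_iff less_ceiling_iff)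
    note z = z(1) this
    then have "x + t * u = of_int z" using assms by simp
    moreover have "0 \<le> t" "t < T" using z assms by (simp_all add: pos_divide_less_eq)
    ultimately show "t \<in> H" by (simp add: H_def)
  qed
  then show "finite H" by simp
  have "inj ?f" using assms by (intro injI) simp
  then show "card H = nat (\<lceil>x + T * u\<rceil> - \<lceil>x\<rceil>)" unfolding H by (simp add: card_image inj_on_subset)
qed

lemma hits_face_scale:
  "c > 0 \<Longrightarrow> hits_face x (u /\<^sub>R c) (c * t) i \<longleftrightarrow> x $ i + t * u $ i \<in> \<int>"
  by (simp add: hits_face_iff field_simps)

text \<open>The first \<open>n\<close> hit times in increasing order give the word. Each integer
  \<open>T\<close> is a hit time of \<open>m\<close>, so the letters preceding that hit record all
  counting functions at \<open>T\<close>, provided these letters are fewer than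
  \<open>n\<close>.\<close>

lemma generic_line_word:
  fixes x u :: "real^'d::finite"
  assumes u: "\<And>i. u $ i > 0" and m: "x $ m = 0" "u $ m = 1"
    and single: "\<And>t i j. x $ i + t * u $ i \<in> \<int> \<Longrightarrow> x $ j + t * u $ j \<in> \<int> \<Longrightarrow> i = j"
    and n: "n \<ge> 1"
  defines "H \<equiv> \<lambda>i T. {t. 0 \<le> t \<and> t < T \<and> x $ i + t * u $ i \<in> \<int>}"
  shows "\<exists>w\<in>billiard_language n. \<forall>T::nat. (\<Sum>i\<in>UNIV. card (H i T)) < n \<longrightarrow>
    (\<exists>k<n. w ! k = m \<and> (\<forall>i. count_list (take k w) i = card (H i T)))"
proof -
  have fH: "finite (H i T)" if "T \<ge> 0" for i T unfolding H_def by (rule card_hits_before) (use u that in auto)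
  have disj: "H i T \<inter> H j T = {}" if "i \<noteq> j" for i j T using single that by (auto simp: H_def)
  have cm: "card (H m T) = T" for T :: nat using card_hits_before(2)[of 1 T 0] by (simp add: H_def m)
  define E where "E = (\<Union>i. H i n)"
  have fE: "finite E" unfolding E_def using fH by simp
  have cU: "card (\<Union>i. H i T) = (\<Sum>i\<in>UNIV. card (H i T))" if "T \<ge> 0" for T
    using fH[OF that] disj by (intro card_UN_disjoint) auto
  define L where "L = sorted_list_of_set E"
  have L: "set L = E" "sorted_wrt (<) L" "length L = card E"
    using fE by (simp_all add: L_def)
  \<comment> \<open>Letter \<open>m\<close> alone supplies \<open>n\<close> hits in
    \<open>[0,n)\<close>.\<close>
  have "n \<le> card E"
  proof -
    have "card (H m n) \<le> card E" using fE by (intro card_mono) (auto simp: E_def)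
    then show ?thesis by (simp add: cm)
  qed
  then have nL: "n \<le> length L" by (simp add: L)
  define s where "s k = L ! k" for k
  have less: "s k < s l \<longleftrightarrow> k < l" if "k < length L" "l < length L" for k l
    using sorted_wrt_nth_less[OF L(2), of k l] sorted_wrt_nth_less[OF L(2), of l k] that
    unfolding s_def by (metis less_asym linorder_less_linear)
  have sE: "s k \<in> E" if "k < length L" for k using that L by (auto simp: s_def)
  have surj: "\<exists>k<length L. s k = t" if "t \<in> E" for t using that L(1) by (auto simp: s_def in_set_conv_nth)
  define w where "w = map (\<lambda>k. THE i. x $ i + s k * u $ i \<in> \<int>) [0..<n]"
  have w: "x $ i + s k * u $ i \<in> \<int> \<longleftrightarrow> i = w ! k" if "k < n" for k i
  proof -
    have "s k \<in> E" using sE that nL by simp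
    then obtain j where j: "x $ j + s k * u $ j \<in> \<int>" by (auto simp: E_def H_def)
    have "(THE i. x $ i + s k * u $ i \<in> \<int>) = j" by (rule the_equality) (use j single in auto)
    then have "w ! k = j" using that by (simp add: w_def)
    then show ?thesis using j single by blast
  qed
  have len: "length w = n" by (simp add: w_def)
  have c: "norm u > 0" using u[of m] by (metis zero_less_norm_iff zero_index less_irrefl)
  have "w \<in> billiard_language n"
    unfolding billiard_language_def
  proof (intro CollectI conjI len)
    \<comment> \<open>Dividing the velocity by its norm multiplies all hit times by
      \<open>norm u\<close>; the segment ends exactly at the last of the \<open>n\<close>
      hits.\<close>
    let ?c = "norm u"
    have "{t \<in> {0..?c * s (n - 1)}. \<exists>i. hits_face x (u /\<^sub>R ?c) t i} = (\<lambda>k. ?c * s k) ` {..<n}"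
    proof (intro equalityI subsetI)
      fix t assume t: "t \<in> {t \<in> {0..?c * s (n - 1)}. \<exists>i. hits_face x (u /\<^sub>R ?c) t i}"
      define r where "r = t / ?c"
      have tr: "t = ?c * r" using c by (simp add: r_def)
      obtain i where "hits_face x (u /\<^sub>R ?c) (?c * r) i" using t unfolding tr by blast
      then have i: "x $ i + r * u $ i \<in> \<int>" by (simp only: hits_face_scale[OF c])
      have r: "0 \<le> r" "r \<le> s (n - 1)" using t c by (auto simp: tr zero_le_mult_iff)
      have sn: "s (n - 1) \<in> E" using sE n nL by simp
      then have "r < n" using r by (auto simp: E_def H_def)
      then have "r \<in> E" using i r by (auto simp: E_def H_def)
      then obtain k where k: "k < length L" "s k = r" using surj by blast
      have "\<not> n - 1 < k" using less[of "n - 1" k] k r n nL by simp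
      then have "k < n" using n by simp
      then show "t \<in> (\<lambda>k. ?c * s k) ` {..<n}" using k tr by blast
    next
      fix t assume "t \<in> (\<lambda>k. ?c * s k) ` {..<n}"
      then obtain k where k: "k < n" "t = ?c * s k" by auto
      have "s k \<le> s (n - 1)" using less[of "n - 1" k] k n nL by (simp add: not_less[symmetric])
      moreover have "0 \<le> s k" using sE[of k] k nL by (auto simp: E_def H_def)
      moreover have "hits_face x (u /\<^sub>R ?c) t (w ! k)" unfolding k(2) hits_face_scale[OF c] w[OF k(1)] ..
      ultimately show "t \<in> {t \<in> {0..?c * s (n - 1)}. \<exists>i. hits_face x (u /\<^sub>R ?c) t i}"
        using c k by (auto simp: mult_left_mono)
    qed
    moreover have "norm (u /\<^sub>R ?c) = 1" using c by simp
    moreover have "\<forall>k. Suc k < n \<longrightarrow> ?c * s k < ?c * s (Suc k)" using less nL c by simp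
    moreover have "\<forall>k<n. \<forall>i. hits_face x (u /\<^sub>R ?c) (?c * s k) i \<longleftrightarrow> i = w ! k"
      unfolding hits_face_scale[OF c] using w by blast
    ultimately show "\<exists>x v a b s. norm v = 1 \<and> (\<forall>k. Suc k < n \<longrightarrow> s k < s (Suc k)) \<and>
        {t \<in> {a..b}. \<exists>i. hits_face x v t i} = s ` {..<n} \<and> (\<forall>k<n. \<forall>i. hits_face x v (s k) i \<longleftrightarrow> i = w ! k)"
      by - (rule exI[of _ x], rule exI[of _ "u /\<^sub>R ?c"], rule exI[of _ 0], rule exI[of _ "?c * s (n - 1)"],
        rule exI[of _ "\<lambda>k. ?c * s k"], blast)
  qed
  moreover have "\<exists>k<n. w ! k = m \<and> (\<forall>i. count_list (take k w) i = card (H i T))"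
    if T: "(\<Sum>i\<in>UNIV. card (H i T)) < n" for T :: nat
  proof -
    have "card (H m T) \<le> (\<Sum>i\<in>UNIV. card (H i T))" by (rule member_le_sum) auto
    then have "T < n" using T by (simp add: cm)
    then have "real T \<in> H m n" by (simp add: H_def m)
    then obtain k where k: "k < length L" "s k = T" using surj[of T] by (auto simp: E_def)
    have "s ` {..<k} = (\<Union>i. H i T)"
    proof (intro equalityI subsetI)
      fix t assume "t \<in> s ` {..<k}"
      then obtain l where l: "l < k" "t = s l" by auto
      then have "t < T" "t \<in> E" using less[of l k] k sE[of l] by auto
      then show "t \<in> (\<Union>i. H i T)" by (auto simp: E_def H_def)
    next
      fix t assume t: "t \<in> (\<Union>i. H i T)"
      then have "t \<in> E" "t < T" using \<open>T < n\<close> by (auto simp: E_def H_def)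
      then obtain l where l: "l < length L" "s l = t" using surj by blast
      then have "l < k" using less[of l k] k \<open>t < T\<close> by simp
      then show "t \<in> s ` {..<k}" using l by blast
    qed
    moreover have inj: "inj_on s {..<length L}"
      using less by (intro inj_onI) (metis lessThan_iff less_irrefl linorder_less_linear)
    then have "card (s ` {..<k}) = k" using k by (simp add: card_image inj_on_subset)
    ultimately have "k < n" using cU[of T] T by simp
    moreover have "w ! k = m" using w[OF \<open>k < n\<close>, of m] by (simp add: m k)
    moreover have "count_list (take k w) i = card (H i T)" for i
    proof -
      have "s ` {l. l < k \<and> w ! l = i} = H i T"
      proof (intro equalityI subsetI)
        fix t assume "t \<in> s ` {l. l < k \<and> w ! l = i}"
        then obtain l where l: "l < k" "w ! l = i" "t = s l" by auto
        have "x $ i + t * u $ i \<in> \<int>" using w[of l i] l \<open>k < n\<close> by simp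
        moreover have "t < T" "t \<in> E" using less[of l k] l k sE[of l] by auto
        ultimately show "t \<in> H i T" by (auto simp: E_def H_def)
      next
        fix t assume t: "t \<in> H i T"
        then obtain l where l: "l < k" "t = s l" using \<open>s ` {..<k} = (\<Union>i. H i T)\<close> by blast
        moreover have "w ! l = i" using w[of l i] l t \<open>k < n\<close> by (simp add: H_def)
        ultimately show "t \<in> s ` {l. l < k \<and> w ! l = i}" by blast
      qed
      moreover have "card (s ` {l. l < k \<and> w ! l = i}) = card {l. l < k \<and> w ! l = i}"
        by (rule card_image[OF inj_on_subset[OF inj]]) (use k in auto)
      ultimately show ?thesis using \<open>k < n\<close> len by (simp add: count_list_take)
    qed
    ultimately show ?thesis by blast
  qed
  ultimately show ?thesis by blast
qed

text \<open>The fraction \<open>\<theta>\<close> leaves the digitization unchanged whatever its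
  value, which frees it for the generic choice of offsets.\<close>

lemma ceiling_add_fraction:
  fixes N q :: nat
  assumes "q > 0" "0 < \<theta>" "\<theta> < 1"
  shows "\<lceil>(real N + \<theta>) / real q\<rceil> = int (N div q) + 1"
proof (rule ceiling_unique)
  have 1: "q * (N div q) \<le> N" by simp
  have 2: "N + 1 \<le> q * (N div q) + q" using dividend_less_times_div[OF assms(1), of N] by simp
  have "real q * real (N div q) < real N + \<theta>" using 1 assms(2) by (metis add_strict_increasing of_nat_le_iff of_nat_mult add.commute)
  then show "of_int (int (N div q) + 1) - 1 < (real N + \<theta>) / real q"
    using assms(1) by (simp add: pos_less_divide_eq mult.commute)
  have "real (N + 1) \<le> real (q * (N div q) + q)" using 2 by (simp only: of_nat_le_iff)
  then have "real N + \<theta> \<le> real q * real (N div q) + real q" using assms(3) by simp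
  then show "(real N + \<theta>) / real q \<le> of_int (int (N div q) + 1)"
    using assms(1) by (simp add: pos_divide_le_eq distrib_left mult.commute)
qed

text \<open>Letter \<open>m\<close> is hit exactly at the integer times and serves as a clock; the other coordinates
  can then be prescribed independently of each other.\<close>

lemma word_with_digital_lines:
  fixes f :: "'d::finite \<Rightarrow> nat \<times> nat \<times> nat"
  assumes f: "\<And>i p q k. i \<noteq> m \<Longrightarrow> f i = (p, q, k) \<Longrightarrow> 0 < p \<and> p < 8 * q \<and> k < q" and n: "n \<ge> 1"
  shows "\<exists>w\<in>billiard_language n. \<forall>T. 8 * CARD('d) * T < n \<longrightarrow>
    (\<exists>k<n. w ! k = m \<and> count_list (take k w) m = T \<and> (\<forall>i. i \<noteq> m \<longrightarrow> count_list (take k w) i = digital_line (f i) T))"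
proof -
  define p q k where "p i = fst (f i)" and "q i = fst (snd (f i))" and "k i = snd (snd (f i))" for i
  have f_eq: "f i = (p i, q i, k i)" for i by (simp add: p_def q_def k_def)
  have pqk: "0 < p i" "p i < 8 * q i" "k i < q i" if "i \<noteq> m" for i using f[OF that f_eq] by auto
  then have q0: "0 < q i" if "i \<noteq> m" for i using that by (metis gr0I less_zeroE)
  \<comment> \<open>The interval for the time offset \<open>\<sigma> i\<close> is the one that makes
    \<open>p i * \<sigma> i\<close> equal to \<open>k i\<close> plus a fraction strictly between 0
    and 1.\<close>
  obtain \<sigma> where \<sigma>m: "\<sigma> m = 0"
    and \<sigma>: "\<And>i. i \<noteq> m \<Longrightarrow> real (k i) / real (p i) < \<sigma> i \<and> \<sigma> i < (real (k i) + 1) / real (p i)"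
    and gen: "\<And>i j. i \<noteq> j \<Longrightarrow> \<sigma> i - \<sigma> j \<notin> \<rat>"
  proof -
    have "\<exists>\<sigma>. \<sigma> m = 0 \<and> (\<forall>i\<in>UNIV - {m}. real (k i) / real (p i) < \<sigma> i \<and> \<sigma> i < (real (k i) + 1) / real (p i)) \<and>
      (\<forall>i\<in>insert m (UNIV - {m}). \<forall>j\<in>insert m (UNIV - {m}). i \<noteq> j \<longrightarrow> \<sigma> i - \<sigma> j \<notin> \<rat>)"
      by (rule rationally_generic_points) (use pqk in \<open>auto simp: divide_strict_right_mono\<close>)
    then show ?thesis using that by auto
  qed
  define \<alpha> where "\<alpha> i = (if i = m then 1 else real (p i) / real (q i))" for i
  have \<alpha>: "\<alpha> i > 0" "\<alpha> i \<in> \<rat>" for i using pqk[of i] q0[of i] by (auto simp: \<alpha>_def)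
  define u x :: "real^'d" where "u = (\<chi> i. \<alpha> i)" and "x = (\<chi> i. \<alpha> i * \<sigma> i)"
  have xu: "x $ i + t * u $ i = \<alpha> i * (\<sigma> i + t)" for i t by (simp add: x_def u_def algebra_simps)
  \<comment> \<open>The speeds are rational, so hitting \<open>i\<close> and \<open>j\<close>
    together at time \<open>t\<close> would make \<open>\<sigma> i + t\<close> and
    \<open>\<sigma> j + t\<close>, hence their difference, rational.\<close>
  have single: "i = j" if "x $ i + t * u $ i \<in> \<int>" "x $ j + t * u $ j \<in> \<int>" for t i j
  proof (rule ccontr)
    assume "i \<noteq> j"
    have R: "\<sigma> i + t \<in> \<rat>" if "x $ i + t * u $ i \<in> \<int>" for i
    proof -
      have "\<alpha> i * (\<sigma> i + t) / \<alpha> i \<in> \<rat>" using that \<alpha>[of i] Ints_subset_Rats unfolding xu by (intro Rats_divide) auto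
      then show ?thesis using \<alpha>[of i] by simp
    qed
    have "(\<sigma> i + t) - (\<sigma> j + t) \<in> \<rat>" using R that by (intro Rats_diff) auto
    then show False using gen[OF \<open>i \<noteq> j\<close>] by simp
  qed
  define H where "H = (\<lambda>i T. {t. 0 \<le> t \<and> t < T \<and> x $ i + t * u $ i \<in> \<int>})"
  have Hm: "card (H m (real T)) = T" for T using card_hits_before(2)[of 1 T 0] by (simp add: H_def xu \<alpha>_def \<sigma>m)
  have Hi: "card (H i (real T)) = digital_line (f i) T" if "i \<noteq> m" for i T
  proof -
    define \<theta> where "\<theta> = real (p i) * \<sigma> i - real (k i)"
    have \<theta>: "0 < \<theta>" "\<theta> < 1" using \<sigma>[OF that] pqk[OF that] by (simp_all add: \<theta>_def field_simps)
    have e: "x $ i + real N * u $ i = (real (N * p i + k i) + \<theta>) / real (q i)" for N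
      using q0[OF that] that by (simp add: xu \<alpha>_def \<theta>_def field_simps)
    have "card (H i (real T)) = nat (\<lceil>x $ i + real T * u $ i\<rceil> - \<lceil>x $ i\<rceil>)"
      unfolding H_def by (rule card_hits_before(2)) (use \<alpha>[of i] in \<open>auto simp: u_def\<close>)
    also have "\<lceil>x $ i + real T * u $ i\<rceil> = int ((T * p i + k i) div q i) + 1"
      unfolding e by (rule ceiling_add_fraction) (use q0[OF that] \<theta> in auto)
    \<comment> \<open>Because \<open>k i < q i\<close>, the line starts between 0 and 1; subtracting
      this 1 cancels the one added at time \<open>T\<close>.\<close>
    also have "\<lceil>x $ i\<rceil> = 1"
    proof -
      have "\<lceil>x $ i\<rceil> = \<lceil>x $ i + real 0 * u $ i\<rceil>" by simp
      also have "\<dots> = int ((0 * p i + k i) div q i) + 1"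
        unfolding e by (rule ceiling_add_fraction) (use q0[OF that] \<theta> in auto)
      finally show ?thesis using pqk[OF that] by simp
    qed
    finally show ?thesis by (simp add: f_eq)
  qed
  \<comment> \<open>Slope below 8 and intercept below 1: this limits how many letters precede the
    hit of \<open>m\<close> at time \<open>T\<close>.\<close>
  have dl: "digital_line (f i) T \<le> 8 * T" if "i \<noteq> m" for i T
  proof -
    have "T * p i \<le> T * (8 * q i)" using pqk[OF that] by (intro mult_le_mono2) auto
    then have "T * p i + k i < T * (8 * q i) + q i" using pqk(3)[OF that] by linarith
    also have "\<dots> = (8 * T + 1) * q i" by (simp add: distrib_right)
    finally have "T * p i + k i < (8 * T + 1) * q i" .
    then have "(T * p i + k i) div q i < 8 * T + 1" using q0[OF that] by (simp add: div_less_iff_less_mult)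
    then show ?thesis by (simp add: f_eq)
  qed
  have bound: "(\<Sum>i\<in>UNIV. card (H i (real T))) \<le> 8 * CARD('d) * T" for T
  proof -
    have "card (H i (real T)) \<le> 8 * T" for i by (cases "i = m") (simp_all add: Hm Hi dl)
    then have "(\<Sum>i\<in>UNIV. card (H i (real T))) \<le> (\<Sum>i\<in>(UNIV::'d set). 8 * T)" by (intro sum_mono)
    then show ?thesis by (simp add: mult_ac)
  qed
  have "\<exists>w\<in>billiard_language n. \<forall>T::nat. (\<Sum>i\<in>UNIV. card (H i T)) < n \<longrightarrow>
    (\<exists>k<n. w ! k = m \<and> (\<forall>i. count_list (take k w) i = card (H i T)))"
    unfolding H_def
  proof (rule generic_line_word[OF _ _ _ single n])
    show "u $ i > 0" for i using \<alpha>(1) by (simp add: u_def)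
    show "x $ m = 0" "u $ m = 1" by (simp_all add: x_def u_def \<sigma>m \<alpha>_def)
  qed
  then obtain w where w: "w \<in> billiard_language n" "\<And>T::nat. (\<Sum>i\<in>UNIV. card (H i T)) < n \<Longrightarrow>
    (\<exists>k<n. w ! k = m \<and> (\<forall>i. count_list (take k w) i = card (H i T)))" by blast
  show ?thesis
  proof (intro bexI[OF _ w(1)] allI impI)
    fix T assume "8 * CARD('d) * T < n"
    then have "(\<Sum>i\<in>UNIV. card (H i (real T))) < n" using bound[of T] by linarith
    from w(2)[OF this] obtain k where "k < n" "w ! k = m" "\<forall>i. count_list (take k w) i = card (H i T)"
      by blast
    then show "\<exists>k<n. w ! k = m \<and> count_list (take k w) m = T \<and>
      (\<forall>i. i \<noteq> m \<longrightarrow> count_list (take k w) i = digital_line (f i) T)"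
      by (intro exI[of _ k]) (simp add: Hm Hi)
  qed
qed

section \<open>The lower bound on the number of words\<close>

text \<open>The count of \<open>m\<close> grows strictly from one occurrence of \<open>m\<close> to
  the next. Hence the position of the clock hit at time \<open>T\<close> depends on the word alone,
  not on the lines that produced it.\<close>

lemma position_unique:
  assumes "w ! k = m" "w ! k' = m" "k < length w" "k' < length w"
    "count_list (take k w) m = count_list (take k' w) m"
  shows "k = k'"
proof -
  have less: "count_list (take i w) m < count_list (take j w) m" if "i < j" "j < length w" "w ! i = m" for i j
  proof -
    have "take j w = take i w @ drop i (take j w)" using that by (metis append_take_drop_id min.absorb1 nless_le take_take)
    moreover have "drop i (take j w) = w ! i # drop (Suc i) (take j w)"
      using that by (simp add: Cons_nth_drop_Suc[symmetric])
    ultimately have "take j w = take i w @ w ! i # drop (Suc i) (take j w)" by simp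
    then have "count_list (take j w) m = count_list (take i w @ w ! i # drop (Suc i) (take j w)) m" by (rule arg_cong)
    then show ?thesis using that(3) by simp
  qed
  show ?thesis using less[of k k'] less[of k' k] assms by (metis less_irrefl linorder_less_linear)
qed

lemma finite_language: "finite (billiard_language n :: 'd::finite list set)"
  by (rule finite_subset[OF _ finite_lists_length_eq[of "UNIV::'d set" n]]) (auto simp: billiard_language_def)

text \<open>A word determines the \<open>d - 1\<close> digitized lines behind it up to time
  \<open>3 * Q\<close>, and thereby their parameters. With at most \<open>8 * d\<close> letters per
  unit of time, this takes \<open>24 * d * Q\<close> letters.\<close>

lemma card_language_lower:
  assumes "24 * CARD('d::finite) * Q < n"
  shows "card (line_params Q) ^ (CARD('d) - 1) \<le> card (billiard_language n :: 'd list set)"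
proof -
  obtain m :: 'd where True by blast
  let ?F = "PiE (UNIV - {m}) (\<lambda>_. line_params Q)"
  define P where "P f w \<longleftrightarrow> (\<forall>T. 8 * CARD('d) * T < n \<longrightarrow>
    (\<exists>k<n. w ! k = m \<and> count_list (take k w) m = T \<and> (\<forall>i. i \<noteq> m \<longrightarrow> count_list (take k w) i = digital_line (f i) T)))" for f w
  have "\<exists>w\<in>billiard_language n. P f w" if "f \<in> ?F" for f
    unfolding P_def
  proof (rule word_with_digital_lines)
    fix i p q k assume "i \<noteq> m" "f i = (p, q, k)"
    then have "(p, q, k) \<in> line_params Q" using that by (metis DiffI PiE_mem UNIV_I singletonD)
    then show "0 < p \<and> p < 8 * q \<and> k < q" by (auto simp: line_params_def)
  qed (use assms in auto)
  then obtain W where W: "\<And>f. f \<in> ?F \<Longrightarrow> W f \<in> billiard_language n" "\<And>f. f \<in> ?F \<Longrightarrow> P f (W f)" by metis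
  have "inj_on W ?F"
  proof (rule inj_onI)
    fix f g assume f: "f \<in> ?F" and g: "g \<in> ?F" and eq: "W f = W g"
    have len: "length (W f) = n" using W(1)[OF f] by (simp add: billiard_language_def)
    have "f i = g i" if i: "i \<in> UNIV - {m}" for i
    proof (rule digital_line_inject)
      show "f i \<in> line_params Q" "g i \<in> line_params Q" using f g i by auto
      fix T assume "T \<le> 3 * Q"
      then have "8 * CARD('d) * T \<le> 8 * CARD('d) * (3 * Q)" by (rule mult_le_mono2)
      then have T: "8 * CARD('d) * T < n" using assms by linarith
      obtain k where k: "k < n" "W f ! k = m" "count_list (take k (W f)) m = T" "\<forall>i. i \<noteq> m \<longrightarrow> count_list (take k (W f)) i = digital_line (f i) T"
        using W(2)[OF f] T unfolding P_def by blast
      obtain l where l: "l < n" "W f ! l = m" "count_list (take l (W f)) m = T" "\<forall>i. i \<noteq> m \<longrightarrow> count_list (take l (W f)) i = digital_line (g i) T"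
        using W(2)[OF g] T unfolding P_def eq by blast
      have "k = l" by (rule position_unique) (use k l len in auto)
      then show "digital_line (f i) T = digital_line (g i) T" using k l i by auto
    qed
    then show "f = g" using f g by (rule_tac PiE_ext) auto
  qed
  then have "card ?F \<le> card (billiard_language n :: 'd list set)"
    by (rule card_inj_on_le) (use W(1) finite_language in auto)
  then show ?thesis by (simp add: card_PiE card_Diff_singleton)
qed

lemma language_nonempty:
  assumes "n \<ge> 1"
  shows "(billiard_language n :: 'd::finite list set) \<noteq> {}"
  using word_with_digital_lines[of undefined "\<lambda>_::'d. (1, 1, 0)" n] assms by auto

text \<open>\<open>Q\<close> is the largest value that the length \<open>n\<close> allows. If
  \<open>Q \<ge> 1\<close>, then \<open>n \<le> 24 * d * (Q + 1) \<le> 48 * d * Q\<close>, and 64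
  comes from the count of lines; if \<open>Q = 0\<close>, the claimed bound is at most 1 and one
  word suffices.\<close>

lemma card_language_lower_power:
  fixes n :: nat
  assumes "n \<ge> 1"
  defines "d \<equiv> CARD('d::finite)"
  shows "(1 / (64 * (48 * real d)^3) ^ (d - 1)) * real n ^ (3 * d - 3) \<le> real (card (billiard_language n :: 'd list set))"
proof -
  have d: "d \<ge> 1" by (simp add: d_def Suc_le_eq)
  have K: "0 < 64 * (48 * real d)^3" using d by simp
  have e: "real n ^ (3 * d - 3) = (real n ^ 3) ^ (d - 1)"
    by (simp add: power_mult[symmetric] diff_mult_distrib2)
  have eq: "(1 / (64 * (48 * real d)^3) ^ (d - 1)) * real n ^ (3 * d - 3) = (real n ^ 3 / (64 * (48 * real d)^3)) ^ (d - 1)"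
    by (simp add: e power_divide)
  define Q where "Q = (n - 1) div (24 * d)"
  show ?thesis
  proof (cases "Q = 0")
    case True
    then have "n - 1 < 24 * d" using d by (auto simp: Q_def div_eq_0_iff)
    then have "real n \<le> 48 * real d" using d by linarith
    then have "real n ^ 3 \<le> (48 * real d)^3" by (intro power_mono) auto
    also have "\<dots> \<le> 64 * (48 * real d)^3" by simp
    finally have "real n ^ 3 / (64 * (48 * real d)^3) \<le> 1" using K by simp
    then have "(real n ^ 3 / (64 * (48 * real d)^3)) ^ (d - 1) \<le> 1" by (intro power_le_one) auto
    also have "1 \<le> real (card (billiard_language n :: 'd list set))"
      using language_nonempty[OF assms(1), where 'd='d] finite_language[of n, where 'd='d] by (simp add: Suc_le_eq card_gt_0_iff)
    finally show ?thesis unfolding eq .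
  next
    case False
    have "n - 1 < 24 * d * (Q + 1)" using d dividend_less_times_div[of "24 * d" "n - 1"] by (simp add: Q_def)
    also have "\<dots> \<le> 24 * d * (2 * Q)" using False by (intro mult_le_mono2) auto
    finally have "n \<le> 48 * d * Q" using assms(1) by linarith
    then have "real n \<le> (48 * real d) * real Q" by (metis of_nat_le_iff of_nat_mult of_nat_numeral)
    then have "real n ^ 3 \<le> ((48 * real d) * real Q)^3" by (intro power_mono) auto
    also have "\<dots> = (48 * real d)^3 * real (Q^3)" by (simp add: power_mult_distrib)
    also have "\<dots> \<le> (48 * real d)^3 * real (64 * card (line_params Q))"
      using card_line_params(2)[of Q] by (intro mult_left_mono) (simp_all only: of_nat_le_iff, simp)
    finally have "real n ^ 3 / (64 * (48 * real d)^3) \<le> real (card (line_params Q))"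
      using K by (simp add: pos_divide_le_eq mult_ac)
    then have "(real n ^ 3 / (64 * (48 * real d)^3)) ^ (d - 1) \<le> real (card (line_params Q)) ^ (d - 1)"
      by (intro power_mono) auto
    also have "\<dots> \<le> real (card (billiard_language n :: 'd list set))"
    proof -
      have "24 * d * Q \<le> n - 1" by (simp add: Q_def)
      then have "24 * d * Q < n" using assms(1) by linarith
      then have "card (line_params Q) ^ (d - 1) \<le> card (billiard_language n :: 'd list set)"
        unfolding d_def by (rule card_language_lower)
      then show ?thesis by (metis of_nat_le_iff of_nat_power)
    qed
    finally show ?thesis unfolding eq .
  qed
qed

theorem theorem1:
  assumes "CARD('d::finite) \<ge> 2"
  shows "\<exists>C1 C2::real. C1 > 0 \<and> C2 > 0 \<and>
    (\<forall>n::nat. n \<ge> 1 \<longrightarrow>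
       C1 * real n ^ (3 * CARD('d) - 3) \<le> real (billiard_complexity TYPE('d) n) \<and>
       real (billiard_complexity TYPE('d) n) \<le> C2 * real n ^ (3 * CARD('d) - 3))"
proof -
  let ?d = "CARD('d)"
  let ?K = "?d * 2 ^ (?d - 1) * (46 * ?d^2) ^ (2 * ?d - 2)"
  have up: "real (billiard_complexity TYPE('d) n) \<le> real ?K * real n ^ (3 * ?d - 3)" if "n \<ge> 1" for n
    using card_language_upper[OF that, where 'd='d] unfolding billiard_complexity_def
    by (metis of_nat_le_iff of_nat_mult of_nat_power)
  have "0 < 1 / (64 * (48 * real ?d)^3) ^ (?d - 1)" "0 < real ?K" by simp_all
  then show ?thesis using card_language_lower_power[where 'd='d] up
    unfolding billiard_complexity_def by blast
qed

end
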